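(* Let $\Sigma\in\mathcal{G}_n$ and let $Q_0$ be the unique regular rational orthogonal matrix with $Q_0^{\rm T}S(\Sigma)Q_0=S(\Sigma^{\rm T})$, with level $\ell_0$. If $Q\in\mathcal{Q}(\Sigma)$ has level $\ell$, then $\ell\mid\ell_0$.
   Context: An oriented graph $\Sigma$ on vertices $v_1,\dots,v_n$ is a simple graph each of whose edges is given a direction. Its skew-adjacency matrix $S(\Sigma)=(s_{ij})$ has $s_{ij}=1$ if $(v_i,v_j)$ is an arc, $-1$ if $(v_j,v_i)$ is an arc, $0$ otherwise. The converse $\Sigma^{\rm T}$ reverses every arc, so $S(\Sigma^{\rm T})=-S(\Sigma)$. Two oriented graphs are generalized cospectral if their skew-adjacency matrices $S$ have the same spectrum and the matrices $J-I-S$ have the same spectrum ($J$ all-one matrix, $I$ identity). Let $e$ be the all-one vector and $W(\Sigma)=[e,Se,\dots,S^{n-1}e]$, $S=S(\Sigma)$. $\mathcal{G}_n$ is the set of $n$-vertex oriented graphs with $2^{-\lfloor n/2\rfloor}\det W(\Sigma)$ an odd square-free integer. A rational orthogonal matrix $Q$ is regular if $Qe=e$; its level is the least positive integer $k$ with $kQ$ integral. $\mathcal{Q}(\Sigma)$ is the set of all regular rational orthogonal matrices $Q$ such that $Q^{\rm T}S(\Sigma)Q=S(\Delta)$ for some oriented graph $\Delta$ generalized cospectral with $\Sigma$. For $\det W(\Sigma)\ne0$ such $Q$ is unique for each $\Delta$, so $Q_0$ is well defined. *)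

theory Defs
  imports "Jordan_Normal_Form.Char_Poly" "HOL-Computational_Algebra.Squarefree"
begin

definition oriented_graph :: "nat \<Rightarrow> (nat \<Rightarrow> nat \<Rightarrow> bool) \<Rightarrow> bool" where
  "oriented_graph n A \<longleftrightarrow> (\<forall>i j. A i j \<longrightarrow> i < n \<and> j < n \<and> i \<noteq> j \<and> \<not> A j i)"

definition skew_adj :: "nat \<Rightarrow> (nat \<Rightarrow> nat \<Rightarrow> bool) \<Rightarrow> rat mat" where
  "skew_adj n A = mat n n (\<lambda>(i,j). if A i j then 1 else if A j i then -1 else 0)"

definition converse_og :: "(nat \<Rightarrow> nat \<Rightarrow> bool) \<Rightarrow> (nat \<Rightarrow> nat \<Rightarrow> bool)" where
  "converse_og A = (\<lambda>i j. A j i)"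

definition all_one_mat :: "nat \<Rightarrow> rat mat" where
  "all_one_mat n = mat n n (\<lambda>_. 1)"

definition all_one_vec :: "nat \<Rightarrow> rat vec" where
  "all_one_vec n = vec n (\<lambda>_. 1)"

definition same_spectrum :: "rat mat \<Rightarrow> rat mat \<Rightarrow> bool" where
  "same_spectrum M N \<longleftrightarrow> char_poly M = char_poly N"

definition gen_cospectral :: "nat \<Rightarrow> (nat \<Rightarrow> nat \<Rightarrow> bool) \<Rightarrow> (nat \<Rightarrow> nat \<Rightarrow> bool) \<Rightarrow> bool" where
  "gen_cospectral n A B \<longleftrightarrow>
     same_spectrum (skew_adj n A) (skew_adj n B) \<and>
     same_spectrum (all_one_mat n - 1\<^sub>m n - skew_adj n A) (all_one_mat n - 1\<^sub>m n - skew_adj n B)"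

definition walk_matrix :: "nat \<Rightarrow> (nat \<Rightarrow> nat \<Rightarrow> bool) \<Rightarrow> rat mat" where
  "walk_matrix n A = mat n n (\<lambda>(i,j). ((skew_adj n A ^\<^sub>m j) *\<^sub>v all_one_vec n) $ i)"

definition in_G :: "nat \<Rightarrow> (nat \<Rightarrow> nat \<Rightarrow> bool) \<Rightarrow> bool" where
  "in_G n A \<longleftrightarrow> oriented_graph n A \<and>
     (\<exists>k::int. odd k \<and> squarefree k \<and> det (walk_matrix n A) = 2 ^ (n div 2) * of_int k)"

definition regular_rat_orth :: "nat \<Rightarrow> rat mat \<Rightarrow> bool" where
  "regular_rat_orth n Q \<longleftrightarrow> Q \<in> carrier_mat n n \<and> transpose_mat Q * Q = 1\<^sub>m n
     \<and> Q *\<^sub>v all_one_vec n = all_one_vec n"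

definition level :: "nat \<Rightarrow> rat mat \<Rightarrow> nat" where
  "level n Q = (LEAST k::nat. 0 < k \<and> (\<forall>i<n. \<forall>j<n. of_nat k * Q $$ (i,j) \<in> \<int>))"

definition Qset :: "nat \<Rightarrow> (nat \<Rightarrow> nat \<Rightarrow> bool) \<Rightarrow> rat mat set" where
  "Qset n A = {Q. regular_rat_orth n Q \<and>
     (\<exists>B. oriented_graph n B \<and> gen_cospectral n A B \<and> transpose_mat Q * skew_adj n A * Q = skew_adj n B)}"

end

(* Fix a prime p, let R be the integers localized at p, e the all-one vector, and
   L = W R^n the cyclic R[S]-module generated by e. It suffices that level(Q0) * Q has
   entries in R for every p.

   For p = 2 the matrix Q itself is integral over R: the Gram matrix of W is even apart from its
   (0,0) entry, and its determinant is the smallest one this allows, so 2 (W^T W)^-1 is integral.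

   For odd p the factor p occurs at most once in det W, so p Q is integral, and only the case
   that Q0 is integral is left. If Q were not, R^n and Q R^n would be two different unimodular
   S-invariant lattices containing L with index p. Since Q0 preserves L and R^n and conjugates S
   to -S, the action of S on R^n / L is zero. Then S annihilates a two-dimensional subspace of
   L / p L, which is impossible because L is cyclic. *)
theory Submission
  imports Defs
begin

text \<open>\<open>Q0\<close> matters because \<open>S\<close> acts on the line R^n / L by a scalar.
  An isometry that preserves R^n and L and turns \<open>S\<close> into \<open>- S\<close> forces
  that scalar to equal its negative, so it vanishes for odd \<open>p\<close>. The two-dimensional
  subspace arises as follows. L has index \<open>p\<close> in R^n and, by W = Q \<open>B.W\<close>,
  also in Q R^n, so p R^n / p L and p Q R^n / p L are lines in L / p L, distinct because the
  lattices are. Membership in L is tested by a single vector v, \<open>p\<close> times a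
  non-integral column of \<open>Q\<close>: an integral u lies in L iff v . u is divisible by
  \<open>p\<close>. As \<open>S\<close> is skew, S v = 0 modulo \<open>p\<close> then already gives
  S R^n inside L. In the basis of walk vectors \<open>S\<close> is a companion matrix, whose kernel
  modulo \<open>p\<close> is at most a line; this is what cyclicity contributes. At 2 none of this
  is available: 2^(n div 2) divides det W, so the index is in general a higher power of 2, and the
  sign argument says nothing modulo 2.\<close>

definition localization :: "int \<Rightarrow> rat set" where
  "localization p = {x. \<exists>m::int. \<not> p dvd m \<and> of_int m * x \<in> \<int>}"

text \<open>For prime \<open>p\<close> this is the maximal ideal of the local ring
  \<open>localization p\<close>. Encoding it by division makes membership of \<open>x\<close>
  literally the integrality of \<open>x / p\<close>.\<close>

definition loc_ideal :: "int \<Rightarrow> rat set" where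
  "loc_ideal p = {x. x / of_int p \<in> localization p}"

definition mat_in :: "'a set \<Rightarrow> 'a mat \<Rightarrow> bool" where
  "mat_in X A \<longleftrightarrow> (\<forall>i<dim_row A. \<forall>j<dim_col A. A $$ (i,j) \<in> X)"

definition vec_in :: "'a set \<Rightarrow> 'a vec \<Rightarrow> bool" where
  "vec_in X v \<longleftrightarrow> (\<forall>i<dim_vec v. v $ i \<in> X)"

lemma mat_inD: "mat_in X A \<Longrightarrow> A \<in> carrier_mat m n \<Longrightarrow> i < m \<Longrightarrow> j < n \<Longrightarrow> A $$ (i,j) \<in> X"
  by (auto simp: mat_in_def)

lemma vec_inD: "vec_in X v \<Longrightarrow> v \<in> carrier_vec n \<Longrightarrow> i < n \<Longrightarrow> v $ i \<in> X"
  by (auto simp: vec_in_def)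

lemma mat_in_mono: "X \<subseteq> Y \<Longrightarrow> mat_in X A \<Longrightarrow> mat_in Y A"
  by (auto simp: mat_in_def)

lemma mat_in_transpose: "mat_in X A \<Longrightarrow> mat_in X (transpose_mat A)"
  by (auto simp: mat_in_def)

lemma sum_closed:
  assumes "0 \<in> X" "\<And>a b. a \<in> X \<Longrightarrow> b \<in> X \<Longrightarrow> a + b \<in> X" "\<And>i. i \<in> I \<Longrightarrow> f i \<in> X"
  shows "sum f I \<in> (X :: 'a :: comm_monoid_add set)"
  using assms(3) by (induction I rule: infinite_finite_induct) (use assms(1,2) in auto)

section \<open>The local ring of the rationals at \<open>p\<close>, and linear algebra over
  it\<close>

locale prime_localization =
  fixes p :: int
  assumes prime_p: "prime p"
begin

abbreviation R :: "rat set" where "R \<equiv> localization p"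
abbreviation P :: "rat set" where "P \<equiv> loc_ideal p"

lemma p_nonzero [simp]: "p \<noteq> 0" "(of_int p :: rat) \<noteq> 0"
  using prime_p by auto

lemma Ints_subset_R: "\<int> \<subseteq> R"
proof
  fix x :: rat assume "x \<in> \<int>"
  moreover have "\<not> p dvd 1" using prime_p by (auto simp: prime_int_iff)
  ultimately show "x \<in> R" unfolding localization_def by (auto intro!: exI[of _ 1])
qed

lemma R_of_int [simp]: "of_int k \<in> R" using Ints_subset_R by auto
lemma R_0 [simp]: "0 \<in> R" using R_of_int[of 0] by simp
lemma R_1 [simp]: "1 \<in> R" using R_of_int[of 1] by simp

lemma R_mult: assumes "x \<in> R" "y \<in> R" shows "x * y \<in> R"
proof -
  from assms obtain a b where ab: "\<not> p dvd a" "of_int a * x \<in> \<int>" "\<not> p dvd b" "of_int b * y \<in> \<int>"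
    unfolding localization_def by auto
  have "\<not> p dvd a * b" using ab prime_p by (simp add: prime_dvd_mult_iff)
  moreover have "of_int (a*b) * (x * y) = (of_int a * x) * (of_int b * y)" by simp
  then have "of_int (a*b) * (x * y) \<in> \<int>" using ab by (metis Ints_mult)
  ultimately show ?thesis unfolding localization_def by blast
qed

lemma R_add: assumes "x \<in> R" "y \<in> R" shows "x + y \<in> R"
proof -
  from assms obtain a b where ab: "\<not> p dvd a" "of_int a * x \<in> \<int>" "\<not> p dvd b" "of_int b * y \<in> \<int>"
    unfolding localization_def by auto
  have "\<not> p dvd a * b" using ab prime_p by (simp add: prime_dvd_mult_iff)
  moreover have "of_int (a*b) * (x + y) = of_int b * (of_int a * x) + of_int a * (of_int b * y)"
    by (simp add: algebra_simps)
  then have "of_int (a*b) * (x + y) \<in> \<int>" using ab by (metis Ints_add Ints_mult Ints_of_int)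
  ultimately show ?thesis unfolding localization_def by blast
qed

lemma R_uminus: "x \<in> R \<Longrightarrow> - x \<in> R" using R_mult[OF R_of_int[of "-1"], of x] by simp
lemma R_diff: "x \<in> R \<Longrightarrow> y \<in> R \<Longrightarrow> x - y \<in> R" using R_add[of x "-y"] R_uminus by simp
lemma R_sum: "(\<And>i. i \<in> I \<Longrightarrow> f i \<in> R) \<Longrightarrow> sum f I \<in> R"
  by (rule sum_closed) (auto intro: R_add)
lemma R_prod: "(\<And>i. i \<in> I \<Longrightarrow> f i \<in> R) \<Longrightarrow> prod f I \<in> R"
  by (induction I rule: infinite_finite_induct) (auto intro: R_mult)

lemma P_eq: "x \<in> P \<longleftrightarrow> (\<exists>y\<in>R. x = of_int p * y)"
proof
  assume "x \<in> P"
  then have "x / of_int p \<in> R" by (simp add: loc_ideal_def)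
  then show "\<exists>y\<in>R. x = of_int p * y" by (intro bexI[of _ "x / of_int p"]) auto
qed (auto simp: loc_ideal_def)

lemma P_0 [simp]: "0 \<in> P" by (simp add: loc_ideal_def)
lemma P_add: "x \<in> P \<Longrightarrow> y \<in> P \<Longrightarrow> x + y \<in> P"
  by (simp add: loc_ideal_def add_divide_distrib R_add)
lemma P_uminus: "x \<in> P \<Longrightarrow> - x \<in> P"
  using R_uminus[of "x / of_int p"] by (simp add: loc_ideal_def)
lemma P_diff: "x \<in> P \<Longrightarrow> y \<in> P \<Longrightarrow> x - y \<in> P"
  by (simp add: loc_ideal_def diff_divide_distrib R_diff)
lemma P_mult_left: "x \<in> R \<Longrightarrow> y \<in> P \<Longrightarrow> x * y \<in> P"
  using R_mult[of x "y / of_int p"] by (simp add: loc_ideal_def)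
lemma P_mult_right: "x \<in> P \<Longrightarrow> y \<in> R \<Longrightarrow> x * y \<in> P"
  using P_mult_left[of y x] by (simp add: mult.commute)
lemma P_sum: "(\<And>i. i \<in> I \<Longrightarrow> f i \<in> P) \<Longrightarrow> sum f I \<in> P"
  by (rule sum_closed) (auto intro: P_add)

lemma of_int_in_P: "p dvd k \<Longrightarrow> of_int k \<in> P"
  by (auto simp: P_eq elim!: dvdE intro!: bexI[of _ "of_int _"])

text \<open>The ring is local: outside \<open>P\<close> the numerator of \<open>x\<close> is prime
  to \<open>p\<close> and can itself serve as a denominator.\<close>

lemma unit_inverse:
  assumes "x \<in> R" "x \<notin> P" shows "1 / x \<in> R"
proof -
  from assms obtain a where a: "\<not> p dvd a" "of_int a * x \<in> \<int>"
    unfolding localization_def by auto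
  then obtain b where b: "of_int a * x = of_int b" by (auto elim: Ints_cases)
  have "\<not> p dvd b"
  proof
    assume "p dvd b"
    then obtain c where c: "b = p * c" by auto
    have "of_int a * (x / of_int p) = of_int c" using b c by (simp add: field_simps)
    then have "x / of_int p \<in> R" using a unfolding localization_def by auto
    with assms show False by (simp add: loc_ideal_def)
  qed
  moreover have "x \<noteq> 0" using assms by auto
  then have "of_int b * (1 / x) = of_int a" using b by (simp add: field_simps)
  ultimately show ?thesis unfolding localization_def by auto
qed

lemma P_prime:
  assumes "x \<in> R" "y \<in> R" "x * y \<in> P" shows "x \<in> P \<or> y \<in> P"
proof (rule ccontr)
  assume H: "\<not> ?thesis"
  then have "1 / x \<in> R" using unit_inverse assms by auto
  from P_mult_left[OF this assms(3)] H show False by (cases "x = 0") auto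
qed

lemma of_int_in_P_iff: "of_int k \<in> P \<longleftrightarrow> p dvd k"
proof
  assume "of_int k \<in> P"
  then obtain m j where m: "\<not> p dvd m" "of_int m * (of_int k / of_int p :: rat) = of_int j"
    unfolding loc_ideal_def localization_def by (auto elim: Ints_cases)
  then have "(of_int (m * k) :: rat) = of_int (j * p)" by (simp add: field_simps)
  then have "m * k = j * p" by (simp only: of_int_eq_iff)
  then have "p dvd m * k" by simp
  with m prime_p show "p dvd k" by (simp add: prime_dvd_mult_iff)
qed (rule of_int_in_P)

lemma scalar_prod_R: "vec_in R v \<Longrightarrow> vec_in R w \<Longrightarrow> dim_vec v = dim_vec w \<Longrightarrow> v \<bullet> w \<in> R"
  unfolding scalar_prod_def by (rule R_sum) (auto simp: vec_in_def intro!: R_mult)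

lemma scalar_prod_P: "vec_in P v \<Longrightarrow> vec_in R w \<Longrightarrow> dim_vec v = dim_vec w \<Longrightarrow> v \<bullet> w \<in> P"
  unfolding scalar_prod_def by (rule P_sum) (auto simp: vec_in_def intro!: P_mult_right)

lemma mult_mat_vec_R: "mat_in R A \<Longrightarrow> vec_in R v \<Longrightarrow> dim_col A = dim_vec v \<Longrightarrow> vec_in R (A *\<^sub>v v)"
  unfolding vec_in_def by (auto simp: mat_in_def vec_in_def intro!: scalar_prod_R)

lemma mult_mat_vec_P: "mat_in R A \<Longrightarrow> vec_in P v \<Longrightarrow> dim_col A = dim_vec v \<Longrightarrow> vec_in P (A *\<^sub>v v)"
  unfolding vec_in_def
  by (auto simp: mat_in_def vec_in_def scalar_prod_def intro!: P_sum P_mult_left)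

lemma mult_mat_R: "mat_in R A \<Longrightarrow> mat_in R B \<Longrightarrow> dim_col A = dim_row B \<Longrightarrow> mat_in R (A * B)"
  unfolding mat_in_def by (auto simp: scalar_prod_def intro!: R_sum R_mult)

lemma det_R: assumes "A \<in> carrier_mat n n" "mat_in R A" shows "det A \<in> R"
proof -
  have "of_int (sign q) \<in> R" for q :: "nat \<Rightarrow> nat" by simp
  then show ?thesis unfolding det_def'[OF assms(1)]
    by (intro R_sum R_mult R_prod) (use assms in \<open>auto simp: mat_in_def sign_def dest: permutes_in_image\<close>)
qed

lemma adj_mat_R: assumes "A \<in> carrier_mat n n" "mat_in R A" shows "mat_in R (adj_mat A)"
proof -
  have "det (mat_delete A j i) \<in> R" if "i < n" "j < n" for i j
    by (rule det_R[OF mat_delete_carrier[OF assms(1)]])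
       (use that assms in \<open>auto simp: mat_in_def mat_delete_def\<close>)
  moreover have "(-1) ^ k \<in> R" for k :: nat using R_of_int[of "(-1)^k"] by simp
  ultimately show ?thesis using assms unfolding mat_in_def adj_mat_def
    by (auto simp: cofactor_def intro!: R_mult)
qed

text \<open>The adjugate turns \<open>A x\<close> into \<open>det A\<close> times \<open>x\<close>,
  and \<open>det A\<close> is a unit. The vector \<open>x\<close> is only assumed rational, so this
  is a source of integrality.\<close>

lemma solve_unit_det:
  assumes A: "A \<in> carrier_mat n n" "mat_in R A" "det A \<notin> P"
    and x: "x \<in> carrier_vec n" "vec_in R (A *\<^sub>v x)"
  shows "vec_in R x"
proof -
  note adj = adj_mat[OF A(1)]
  have d: "1 / det A \<in> R" using unit_inverse[OF det_R] A by auto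
  have d0: "det A \<noteq> 0" using A by auto
  have "adj_mat A *\<^sub>v (A *\<^sub>v x) = det A \<cdot>\<^sub>v x"
    unfolding assoc_mult_mat_vec[OF adj(1) A(1) x(1), symmetric] adj(3) using x(1)
    by (intro eq_vecI) auto
  moreover have "vec_in R (adj_mat A *\<^sub>v (A *\<^sub>v x))"
    by (rule mult_mat_vec_R[OF adj_mat_R]) (use A x adj in auto)
  ultimately have *: "vec_in R (det A \<cdot>\<^sub>v x)" by simp
  show ?thesis unfolding vec_in_def
  proof (intro allI impI)
    fix i assume i: "i < dim_vec x"
    then have "det A * x $ i \<in> R" using * by (auto simp: vec_in_def)
    from R_mult[OF d this] d0 show "x $ i \<in> R" by simp
  qed
qed

end

section \<open>Krylov matrices and polynomials in a matrix\<close>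

definition krylov :: "'a :: semiring_1 mat \<Rightarrow> 'a vec \<Rightarrow> 'a mat" where
  "krylov S e = mat (dim_row S) (dim_row S) (\<lambda>(i,j). ((S ^\<^sub>m j) *\<^sub>v e) $ i)"

text \<open>Coordinates \<open>a\<close> of a vector relative to the Krylov columns are read as
  polynomial coefficients: the resulting matrix commutes with \<open>S\<close> and sends
  \<open>e\<close> to \<open>W a\<close>.\<close>

primrec mat_poly :: "'a :: semiring_1 mat \<Rightarrow> (nat \<Rightarrow> 'a) \<Rightarrow> nat \<Rightarrow> 'a mat" where
  "mat_poly S a 0 = 0\<^sub>m (dim_row S) (dim_row S)"
| "mat_poly S a (Suc k) = mat_poly S a k + a k \<cdot>\<^sub>m (S ^\<^sub>m k)"

lemma mult_mat_vec_sum: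
  "A \<in> carrier_mat n m \<Longrightarrow> x \<in> carrier_vec m \<Longrightarrow> r < n \<Longrightarrow> (A *\<^sub>v x) $ r = (\<Sum>j<m. A $$ (r,j) * x $ j)"
  by (auto simp: scalar_prod_def atLeast0LessThan intro!: sum.cong)

lemma pow_mat_commute:
  fixes S :: "'a :: semiring_1 mat"
  assumes "S \<in> carrier_mat n n" "A \<in> carrier_mat n n" "A * S = S * A"
  shows "A * S ^\<^sub>m k = S ^\<^sub>m k * A"
proof (induction k)
  case 0
  then show ?case using assms by simp
next
  case (Suc k)
  have c: "S ^\<^sub>m k \<in> carrier_mat n n" using assms by simp
  have "A * S ^\<^sub>m Suc k = (S ^\<^sub>m k * A) * S"
    using assoc_mult_mat[OF assms(2) c assms(1)] Suc by simp
  also have "\<dots> = S ^\<^sub>m Suc k * A"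
    using assoc_mult_mat[OF c assms(2,1)] assoc_mult_mat[OF c assms(1,2)] assms(3) by simp
  finally show ?case .
qed

lemma mat_poly_carrier [simp]: "S \<in> carrier_mat n n \<Longrightarrow> mat_poly S a k \<in> carrier_mat n n"
  by (induction k) auto

lemma mat_poly_commute:
  fixes S :: "'a :: comm_ring_1 mat"
  assumes S: "S \<in> carrier_mat n n" and A: "A \<in> carrier_mat n n" "A * S = S * A"
  shows "A * mat_poly S a k = mat_poly S a k * A"
proof (induction k)
  case 0
  then show ?case using S A by simp
next
  case (Suc k)
  have c: "S ^\<^sub>m k \<in> carrier_mat n n" "mat_poly S a k \<in> carrier_mat n n" using S by simp_all
  show ?case
    using mult_add_distrib_mat[OF A(1) c(2), of "a k \<cdot>\<^sub>m S ^\<^sub>m k"]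
      add_mult_distrib_mat[OF c(2), of "a k \<cdot>\<^sub>m S ^\<^sub>m k" A n] Suc pow_mat_commute[OF S A, of k]
      mult_smult_distrib[OF A(1) c(1)] mult_smult_assoc_mat[OF c(1) A(1)] c A(1)
    by simp
qed

lemma mat_poly_mult_vec:
  fixes S :: "'a :: comm_ring_1 mat"
  assumes S: "S \<in> carrier_mat n n" and x: "x \<in> carrier_vec n" and r: "r < n"
  shows "(mat_poly S a k *\<^sub>v x) $ r = (\<Sum>i<k. a i * (S ^\<^sub>m i *\<^sub>v x) $ r)"
proof (induction k)
  case 0
  then show ?case using S x r by simp
next
  case (Suc k)
  have c: "S ^\<^sub>m k \<in> carrier_mat n n" "mat_poly S a k \<in> carrier_mat n n" using S by simp_all
  have "(a k \<cdot>\<^sub>m (S ^\<^sub>m k)) *\<^sub>v x = a k \<cdot>\<^sub>v (S ^\<^sub>m k *\<^sub>v x)"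
    by (intro eq_vecI) (use c x in \<open>auto simp: scalar_prod_def sum_distrib_left mult.assoc\<close>)
  then show ?case
    using add_mult_distrib_mat_vec[OF c(2), of "a k \<cdot>\<^sub>m S ^\<^sub>m k" x] Suc carrier_matD[OF c(1)] c x r
    by (simp del: index_mult_mat_vec)
qed

lemma mult_mat_vec_inverse_exists:
  fixes W :: "'a :: field mat"
  assumes W: "W \<in> carrier_mat n n" "det W \<noteq> 0" and u: "u \<in> carrier_vec n"
  obtains a where "a \<in> carrier_vec n" "W *\<^sub>v a = u"
proof
  note adj = adj_mat[OF W(1)]
  let ?a = "adj_mat W *\<^sub>v ((1 / det W) \<cdot>\<^sub>v u)"
  show "?a \<in> carrier_vec n" using adj u by simp
  have "(1 / det W) \<cdot>\<^sub>v u \<in> carrier_vec n" using u by simp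
  from assoc_mult_mat_vec[OF W(1) adj(1) this]
  have "W *\<^sub>v ?a = (det W \<cdot>\<^sub>m 1\<^sub>m n) *\<^sub>v ((1 / det W) \<cdot>\<^sub>v u)"
    unfolding adj(2) ..
  also have "\<dots> = u" using u W(2) by (intro eq_vecI) auto
  finally show "W *\<^sub>v ?a = u" .
qed

lemma right_cancel_mat:
  fixes W :: "'a :: field mat"
  assumes W: "W \<in> carrier_mat n n" "det W \<noteq> 0"
    and A: "A \<in> carrier_mat n n" "B \<in> carrier_mat n n" "A * W = B * W"
  shows "A = B"
proof -
  note adj = adj_mat[OF W(1)]
  have "A * (W * adj_mat W) = B * (W * adj_mat W)"
    using A assoc_mult_mat[OF A(1) W(1) adj(1)] assoc_mult_mat[OF A(2) W(1) adj(1)] by simp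
  then have "det W \<cdot>\<^sub>m A = det W \<cdot>\<^sub>m B"
    unfolding adj(2) using A mult_smult_distrib[OF A(1), of "1\<^sub>m n" n "det W"]
      mult_smult_distrib[OF A(2), of "1\<^sub>m n" n "det W"] by simp
  then have "det W * A $$ (i,j) = det W * B $$ (i,j)" if "i < n" "j < n" for i j
    using that A by (metis index_smult_mat(1) carrier_matD)
  then show ?thesis using W A by (intro eq_matI) auto
qed

lemma scalar_prod_adjoint:
  fixes A :: "'a :: comm_semiring_0 mat"
  assumes "A \<in> carrier_mat n n" "x \<in> carrier_vec n" "y \<in> carrier_vec n"
  shows "(A *\<^sub>v x) \<bullet> y = x \<bullet> (transpose_mat A *\<^sub>v y)"
  using transpose_vec_mult_scalar[of "transpose_mat A" n n y x] assms
    comm_scalar_prod[of "A *\<^sub>v x" n y] comm_scalar_prod[of x n "transpose_mat A *\<^sub>v y"]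
  by simp

lemma smult_mat_mult_vec:
  fixes A :: "'a :: comm_semiring_0 mat"
  assumes "A \<in> carrier_mat n m" "x \<in> carrier_vec m"
  shows "(c \<cdot>\<^sub>m A) *\<^sub>v x = c \<cdot>\<^sub>v (A *\<^sub>v x)"
  by (intro eq_vecI) (use assms in \<open>auto simp: scalar_prod_def sum_distrib_left mult.assoc\<close>)

context prime_localization begin

lemma pow_mat_R: "S \<in> carrier_mat n n \<Longrightarrow> mat_in R S \<Longrightarrow> mat_in R (S ^\<^sub>m k)"
proof (induction k)
  case 0
  then show ?case by (auto simp: mat_in_def)
next
  case (Suc k)
  then show ?case by (auto intro!: mult_mat_R)
qed

lemma mat_poly_R:
  assumes S: "S \<in> carrier_mat n n" "mat_in R S" and "\<And>i. i < k \<Longrightarrow> a i \<in> R"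
  shows "mat_in R (mat_poly S a k)"
  using assms(3)
proof (induction k)
  case 0
  then show ?case by (auto simp: mat_in_def)
next
  case (Suc k)
  have "mat_in R (S ^\<^sub>m k)" by (rule pow_mat_R[OF S])
  moreover have "mat_in R (mat_poly S a k)" "a k \<in> R" using Suc by auto
  ultimately show ?case using S mat_poly_carrier[OF S(1), of a k]
    by (auto simp: mat_in_def intro!: R_add R_mult)
qed

text \<open>Replacing row \<open>i\<close> of \<open>W\<close> by \<open>v\<^sup>T W / p\<close> gives a matrix over \<open>R\<close> with unit determinant.\<close>
lemma solve_index_p:
  assumes W: "W \<in> carrier_mat n n" "mat_in R W" "det W \<in> P" "det W / of_int p \<notin> P"
    and v: "v \<in> carrier_vec n" "vec_in R v" "vec_in P (transpose_mat W *\<^sub>v v)" "i < n" "v $ i \<notin> P"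
    and a: "a \<in> carrier_vec n" "vec_in R (W *\<^sub>v a)" "v \<bullet> (W *\<^sub>v a) \<in> P"
  shows "vec_in R a"
proof -
  let ?v = "(1 / of_int p) \<cdot>\<^sub>v v"
  define V where "V = replace_col (transpose_mat W) (transpose_mat W *\<^sub>v ?v) i"
  have V: "V \<in> carrier_mat n n" using W by (auto simp: V_def replace_col_def)
  have Wv: "transpose_mat W *\<^sub>v ?v = (1 / of_int p) \<cdot>\<^sub>v (transpose_mat W *\<^sub>v v)"
    using W v by (intro mult_mat_vec[of _ n n]) auto
  have vW: "((transpose_mat W *\<^sub>v ?v) $ k) \<in> R" if "k < n" for k
    unfolding Wv using v(3) W that by (auto simp: vec_in_def loc_ideal_def)
  have VR: "mat_in R V"
    using W vW by (auto simp: mat_in_def V_def replace_col_def simp del: index_mult_mat_vec)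
  \<comment> \<open>Replacing column \<open>i\<close> of a matrix by its product with a vector
    multiplies the determinant by entry \<open>i\<close> of that vector. Here that entry is
    \<open>v $ i / p\<close>, so the single factor \<open>p\<close> of \<open>det W\<close> is
    cancelled and a unit is left.\<close>
  have "det V = ?v $ i * det (transpose_mat W)" unfolding V_def
    by (rule cramer_lemma_mat) (use W v in auto)
  then have detV: "det V = v $ i * (det W / of_int p)" using det_transpose[OF W(1)] v by simp
  have "det V \<notin> P"
    unfolding detV using P_prime[of "v $ i" "det W / of_int p"] v W by (auto simp: vec_in_def loc_ideal_def)
  \<comment> \<open>Row \<open>i\<close> gives \<open>v . (W a) / p\<close>, integral by the assumed
    congruence; every other row gives an entry of \<open>W a\<close>.\<close>
  moreover have "vec_in R (transpose_mat V *\<^sub>v a)"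
    unfolding vec_in_def
  proof (intro allI impI)
    fix r assume "r < dim_vec (transpose_mat V *\<^sub>v a)"
    then have r: "r < n" using V by simp
    show "(transpose_mat V *\<^sub>v a) $ r \<in> R"
    proof (cases "r = i")
      case True
      have "col V i = transpose_mat W *\<^sub>v ?v"
        using W v by (intro eq_vecI) (auto simp: V_def replace_col_def)
      then have "(transpose_mat V *\<^sub>v a) $ r = (transpose_mat W *\<^sub>v ?v) \<bullet> a"
        using r V True by simp
      also have "\<dots> = ?v \<bullet> (W *\<^sub>v a)"
        using scalar_prod_adjoint[of "transpose_mat W" n ?v a] W v a by simp
      also have "\<dots> = (v \<bullet> (W *\<^sub>v a)) / of_int p"
        using smult_scalar_prod_distrib[of v n "W *\<^sub>v a"] v W a by simp
      finally show ?thesis using a by (simp add: loc_ideal_def)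
    next
      case False
      have "col V r = row W r"
        using W v r False by (intro eq_vecI) (auto simp: V_def replace_col_def)
      then have "(transpose_mat V *\<^sub>v a) $ r = (W *\<^sub>v a) $ r" using r V W by simp
      then show ?thesis using a r W by (auto simp: vec_in_def)
    qed
  qed
  moreover have "det (transpose_mat V) = det V" using det_transpose[OF V] .
  moreover have "mat_in R (transpose_mat V)" by (rule mat_in_transpose[OF VR])
  ultimately show ?thesis using solve_unit_det[of "transpose_mat V" n a] V a by auto
qed

end

section \<open>The walk matrix of an integral skew-symmetric matrix\<close>

locale skew_walk =
  fixes n :: nat and S :: "rat mat" and e :: "rat vec"
  assumes S [simp]: "S \<in> carrier_mat n n" and skew: "transpose_mat S = - S"
    and S_Ints: "mat_in \<int> S"
    and e_def: "e = all_one_vec n"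
begin

definition W where "W = krylov S e"

lemma S_dim [simp]: "dim_row S = n" "dim_col S = n" using carrier_matD[OF S] .

lemma e_carrier [simp]: "e \<in> carrier_vec n" by (simp add: e_def all_one_vec_def)
lemma e_dim [simp]: "dim_vec e = n" using carrier_vecD[OF e_carrier] .
lemma e_index [simp]: "i < n \<Longrightarrow> e $ i = 1" by (simp add: e_def all_one_vec_def)

lemma W_carrier [simp]: "W \<in> carrier_mat n n" by (simp add: W_def krylov_def)

lemma Se_carrier [simp]: "S ^\<^sub>m k *\<^sub>v e \<in> carrier_vec n"
  by (rule mult_mat_vec_carrier[of _ n n]) auto

lemma S_pow_Suc: "S *\<^sub>v (S ^\<^sub>m k *\<^sub>v e) = S ^\<^sub>m Suc k *\<^sub>v e"
  using pow_mat_commute[OF S S refl, of k] assoc_mult_mat_vec[OF S, of "S ^\<^sub>m k" n e] by simp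

lemma W_index: "i < n \<Longrightarrow> j < n \<Longrightarrow> W $$ (i,j) = (S ^\<^sub>m j *\<^sub>v e) $ i"
  by (simp add: W_def krylov_def)

lemma W_dim [simp]: "dim_row W = n" "dim_col W = n" using carrier_matD[OF W_carrier] .

lemma W_col: "j < n \<Longrightarrow> col W j = S ^\<^sub>m j *\<^sub>v e"
  by (intro eq_vecI) (auto simp: W_def krylov_def)

lemma W_transpose_index: "x \<in> carrier_vec n \<Longrightarrow> k < n \<Longrightarrow> (transpose_mat W *\<^sub>v x) $ k = (S ^\<^sub>m k *\<^sub>v e) \<bullet> x"
  using W_col by simp

lemma W_mult_index:
  "a \<in> carrier_vec n \<Longrightarrow> r < n \<Longrightarrow> (W *\<^sub>v a) $ r = (\<Sum>i<n. a $ i * (S ^\<^sub>m i *\<^sub>v e) $ r)"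
  unfolding mult_mat_vec_sum[OF W_carrier] by (intro sum.cong) (simp_all add: W_index mult.commute)

lemma mat_poly_e: "a \<in> carrier_vec n \<Longrightarrow> mat_poly S (\<lambda>i. a $ i) n *\<^sub>v e = W *\<^sub>v a"
  by (intro eq_vecI) (use carrier_matD[OF mat_poly_carrier[OF S]] in \<open>auto simp: mat_poly_mult_vec[OF S e_carrier] W_mult_index simp del: index_mult_mat_vec\<close>)

lemma S_adjoint: "x \<in> carrier_vec n \<Longrightarrow> y \<in> carrier_vec n \<Longrightarrow> (S *\<^sub>v x) \<bullet> y = - (x \<bullet> (S *\<^sub>v y))"
  using scalar_prod_adjoint[OF S, of x y] skew by (simp add: uminus_mult_mat_vec)

text \<open>In Krylov coordinates \<open>S\<close> acts as a companion matrix: coordinates move up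
  by one place and the last one is fed back through \<open>c\<close>, the coordinates of
  \<open>S^n e\<close>.\<close>

lemma S_W_shift:
  assumes a: "a \<in> carrier_vec n" and c: "c \<in> carrier_vec n" "W *\<^sub>v c = S ^\<^sub>m n *\<^sub>v e" and n: "0 < n"
  shows "S *\<^sub>v (W *\<^sub>v a) = W *\<^sub>v vec n (\<lambda>j. (if j = 0 then 0 else a $ (j - 1)) + a $ (n - 1) * c $ j)"
    (is "_ = W *\<^sub>v ?b")
proof (intro eq_vecI)
  fix r assume "r < dim_vec (W *\<^sub>v ?b)"
  then have r: "r < n" using W_carrier by simp
  obtain m where m: "n = Suc m" using n by (cases n) auto
  define u where "u k = (S ^\<^sub>m k *\<^sub>v e) $ r" for k
  have "(S *\<^sub>v (W *\<^sub>v a)) $ r = (\<Sum>j<n. S $$ (r,j) * (\<Sum>i<n. a $ i * (S ^\<^sub>m i *\<^sub>v e) $ j))"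
    using r a W_mult_index[OF a] mult_mat_vec_sum[OF S, of "W *\<^sub>v a" r]
    by (simp del: index_mult_mat_vec add: mult_mat_vec_carrier[OF W_carrier])
  also have "\<dots> = (\<Sum>i<n. a $ i * (\<Sum>j<n. S $$ (r,j) * (S ^\<^sub>m i *\<^sub>v e) $ j))"
    unfolding sum_distrib_left by (subst sum.swap) (simp add: mult.left_commute)
  also have "\<dots> = (\<Sum>i<n. a $ i * u (Suc i))"
  proof (intro sum.cong refl arg_cong2[where f = "(*)"])
    fix i
    have "u (Suc i) = (S *\<^sub>v (S ^\<^sub>m i *\<^sub>v e)) $ r" unfolding u_def S_pow_Suc ..
    also have "\<dots> = (\<Sum>j<n. S $$ (r,j) * (S ^\<^sub>m i *\<^sub>v e) $ j)"
      by (rule mult_mat_vec_sum[OF S Se_carrier r])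
    finally show "(\<Sum>j<n. S $$ (r,j) * (S ^\<^sub>m i *\<^sub>v e) $ j) = u (Suc i)" ..
  qed
  also have "\<dots> = (\<Sum>i<m. a $ i * u (Suc i)) + a $ m * u n"
    unfolding m by simp
  also have "u n = (\<Sum>i<n. c $ i * u i)"
    unfolding u_def c(2)[symmetric] using W_mult_index[OF c(1) r] .
  finally have 1: "(S *\<^sub>v (W *\<^sub>v a)) $ r = (\<Sum>i<m. a $ i * u (Suc i)) + a $ m * (\<Sum>i<n. c $ i * u i)" .
  have "(W *\<^sub>v ?b) $ r = (\<Sum>i<n. ?b $ i * u i)"
    unfolding u_def by (rule W_mult_index[OF _ r]) simp
  also have "\<dots> = (\<Sum>i<n. (if i = 0 then 0 else a $ (i - 1)) * u i) + a $ m * (\<Sum>i<n. c $ i * u i)"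
    by (simp add: m algebra_simps sum.distrib sum_distrib_left)
  also have "(\<Sum>i<n. (if i = 0 then 0 else a $ (i - 1)) * u i) = (\<Sum>i<m. a $ i * u (Suc i))"
    unfolding m by (subst sum.lessThan_Suc_shift) simp
  finally show "(S *\<^sub>v (W *\<^sub>v a)) $ r = (W *\<^sub>v ?b) $ r" using 1 by simp
qed (use W_carrier in auto)

end

section \<open>Transport of walk vectors by an orthogonal conjugation\<close>

lemma orthogonal_transpose:
  fixes Q :: "'a :: field mat"
  assumes "Q \<in> carrier_mat n n" "transpose_mat Q * Q = 1\<^sub>m n"
  shows "Q * transpose_mat Q = 1\<^sub>m n"
  using mat_mult_left_right_inverse[OF _ assms(1) assms(2)] assms(1) by simp

lemma scalar_prod_orthogonal:
  fixes Q :: "'a :: field mat"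
  assumes Q: "Q \<in> carrier_mat n n" "transpose_mat Q * Q = 1\<^sub>m n"
    and x: "x \<in> carrier_vec n" "y \<in> carrier_vec n"
  shows "(Q *\<^sub>v x) \<bullet> (Q *\<^sub>v y) = x \<bullet> y"
proof -
  have "(Q *\<^sub>v x) \<bullet> (Q *\<^sub>v y) = x \<bullet> (transpose_mat Q *\<^sub>v (Q *\<^sub>v y))"
    by (rule scalar_prod_adjoint) (use Q x in auto)
  then show ?thesis using assoc_mult_mat_vec[of "transpose_mat Q" n n Q n y] Q x by simp
qed

lemma orthogonal_conj_commute:
  fixes Q :: "'a :: field mat"
  assumes Q: "Q \<in> carrier_mat n n" "transpose_mat Q * Q = 1\<^sub>m n"
    and S: "S \<in> carrier_mat n n" and T: "transpose_mat Q * S * Q = T"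
  shows "S * Q = Q * T"
proof -
  have "Q * T = (Q * transpose_mat Q) * (S * Q)"
    unfolding T[symmetric] using Q(1) S assoc_mult_mat[of Q n n "transpose_mat Q" n "S * Q" n]
      assoc_mult_mat[of "transpose_mat Q" n n S n Q n] by simp
  then show ?thesis using orthogonal_transpose[OF Q] Q S by simp
qed

locale skew_conj = skew_walk n S e + B: skew_walk n T e for n S e T +
  fixes Q :: "rat mat"
  assumes Q [simp]: "Q \<in> carrier_mat n n" and orth: "transpose_mat Q * Q = 1\<^sub>m n"
    and Q_e: "Q *\<^sub>v e = e" and conj: "transpose_mat Q * S * Q = T"
begin

lemma Q_dim [simp]: "dim_row Q = n" "dim_col Q = n" using carrier_matD[OF Q] .

lemma SQ: "S * Q = Q * T"
  by (rule orthogonal_conj_commute[OF Q orth S conj])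

lemma S_Q_vec: "y \<in> carrier_vec n \<Longrightarrow> S *\<^sub>v (Q *\<^sub>v y) = Q *\<^sub>v (T *\<^sub>v y)"
  using assoc_mult_mat_vec[OF S Q] assoc_mult_mat_vec[OF Q B.S] SQ by metis

lemma S_pow_e: "S ^\<^sub>m k *\<^sub>v e = Q *\<^sub>v (T ^\<^sub>m k *\<^sub>v e)"
proof (induction k)
  case 0
  then show ?case using Q_e by simp
next
  case (Suc k)
  then show ?case unfolding S_pow_Suc[symmetric] B.S_pow_Suc[symmetric] by (simp add: S_Q_vec)
qed

lemma S_pow_Q_vec: "y \<in> carrier_vec n \<Longrightarrow> S ^\<^sub>m k *\<^sub>v (Q *\<^sub>v y) = Q *\<^sub>v (T ^\<^sub>m k *\<^sub>v y)"
proof (induction k arbitrary: y)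
  case 0
  then show ?case using mult_mat_vec_carrier[OF Q] by simp
next
  case (Suc k)
  have c: "S ^\<^sub>m k \<in> carrier_mat n n" "T ^\<^sub>m k \<in> carrier_mat n n" by simp_all
  show ?case
    using Suc.IH[of "T *\<^sub>v y"] Suc.prems assoc_mult_mat_vec[OF c(1) S, of "Q *\<^sub>v y"]
      assoc_mult_mat_vec[OF c(2) B.S, of y] by (simp add: S_Q_vec mult_mat_vec_carrier[OF Q] mult_mat_vec_carrier[OF B.S])
qed

lemma walk_scalar_prod: "y \<in> carrier_vec n \<Longrightarrow> (S ^\<^sub>m k *\<^sub>v e) \<bullet> (Q *\<^sub>v y) = (T ^\<^sub>m k *\<^sub>v e) \<bullet> y"
  unfolding S_pow_e by (rule scalar_prod_orthogonal[OF Q orth]) auto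

text \<open>Gives integral products with the walk vectors even where \<open>Q y\<close> itself is
  not integral.\<close>

lemma W_transpose_Q: "y \<in> carrier_vec n \<Longrightarrow> transpose_mat W *\<^sub>v (Q *\<^sub>v y) = transpose_mat B.W *\<^sub>v y"
  by (intro eq_vecI)
    (simp_all add: W_transpose_index B.W_transpose_index walk_scalar_prod mult_mat_vec_carrier[OF Q] del: index_mult_mat_vec)

lemma W_Q: "transpose_mat Q * W = B.W"
proof (intro eq_matI)
  fix i j assume "i < dim_row B.W" "j < dim_col B.W"
  then have ij: "i < n" "j < n" by simp_all
  have "(transpose_mat Q * W) $$ (i,j) = (transpose_mat Q *\<^sub>v (Q *\<^sub>v (T ^\<^sub>m j *\<^sub>v e))) $ i"
    using ij by (simp add: W_col S_pow_e)
  also have "\<dots> = (T ^\<^sub>m j *\<^sub>v e) $ i"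
    using assoc_mult_mat_vec[of "transpose_mat Q" n n Q n "T ^\<^sub>m j *\<^sub>v e"] orth by simp
  finally show "(transpose_mat Q * W) $$ (i,j) = B.W $$ (i,j)" using ij by (simp add: B.W_index)
qed auto

end

context skew_walk begin

lemma W_R: "prime p \<Longrightarrow> mat_in (localization p) W"
proof -
  assume "prime p"
  then interpret prime_localization p by unfold_locales
  have SR: "mat_in R S" using mat_in_mono[OF Ints_subset_R S_Ints] .
  have "vec_in R (S ^\<^sub>m k *\<^sub>v e)" for k
    by (intro mult_mat_vec_R pow_mat_R[OF S SR]) (auto simp: vec_in_def e_def all_one_vec_def)
  then show ?thesis by (auto simp: mat_in_def W_index vec_in_def simp del: index_mult_mat_vec)
qed

end

section \<open>Integrality of \<open>Q\<close> at primes dividing \<open>det W\<close> at most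
  once\<close>

locale skew_conj_at_prime = skew_conj n S e T Q + prime_localization p for n S e T Q p +
  assumes det_W: "det W \<noteq> 0"
begin

lemma SR: "mat_in R S" using mat_in_mono[OF Ints_subset_R S_Ints] .
lemma TR: "mat_in R T" using mat_in_mono[OF Ints_subset_R B.S_Ints] .
lemma WR: "mat_in R W" using W_R[OF prime_p] .
lemma BWR: "mat_in R B.W" using B.W_R[OF prime_p] .
lemma BWTR: "mat_in R (transpose_mat B.W)" by (rule mat_in_transpose[OF BWR])

lemma eR: "vec_in R e" by (simp add: vec_in_def)

lemma powR: "vec_in R (S ^\<^sub>m k *\<^sub>v e)" "vec_in R (T ^\<^sub>m k *\<^sub>v e)"
  using mult_mat_vec_R[OF pow_mat_R[OF S SR] eR] mult_mat_vec_R[OF pow_mat_R[OF B.S TR] eR] by simp_all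

text \<open>The transpose of \<open>Q\<close> is \<open>B.W\<close> times the inverse of
  \<open>W\<close>, so the adjugate formula bounds its denominators by \<open>det W\<close>.\<close>

lemma det_mult_Q_R:
  assumes "i < n" "j < n" shows "det W * Q $$ (i,j) \<in> R"
proof -
  note adj = adj_mat[OF W_carrier]
  have "mat_in R (B.W * adj_mat W)"
    by (intro mult_mat_R adj_mat_R[OF W_carrier] WR BWR) (use adj in auto)
  moreover have "B.W * adj_mat W = det W \<cdot>\<^sub>m transpose_mat Q"
    unfolding W_Q[symmetric] using assoc_mult_mat[of "transpose_mat Q" n n W n "adj_mat W" n] adj
      mult_smult_distrib[of "transpose_mat Q" n n "1\<^sub>m n" n "det W"] by simp
  ultimately have "mat_in R (det W \<cdot>\<^sub>m transpose_mat Q)" by simp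
  from mat_inD[OF this, of n n j i] assms show ?thesis by simp
qed

lemma Q_R_if_det_unit:
  assumes "det W \<notin> P" shows "mat_in R Q"
proof -
  have 1: "1 / det W \<in> R" by (rule unit_inverse[OF det_R[OF W_carrier WR] assms])
  show ?thesis unfolding mat_in_def
  proof (intro allI impI)
    fix i j assume "i < dim_row Q" "j < dim_col Q"
    then show "Q $$ (i,j) \<in> R" using R_mult[OF 1 det_mult_Q_R[of i j]] det_W by simp
  qed
qed

lemma p_Q_R:
  assumes "det W / of_int p \<in> R" "det W / of_int p \<notin> P" "i < n" "j < n"
  shows "of_int p * Q $$ (i,j) \<in> R"
  using R_mult[OF unit_inverse[OF assms(1,2)] det_mult_Q_R[OF assms(3,4)]] det_W by simp

text \<open>The subspace of \<open>L / p L\<close> annihilated by \<open>S\<close> is spanned by \<open>p e\<^sub>i\<close> and by a column \<open>v\<close> of \<open>p Q\<close>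
  whose entry \<open>i\<close> is a unit. Modulo \<open>p\<close>, \<open>v\<close> spans the left kernel of \<open>W\<close>, so it is an eigenvector of
  both \<open>S\<close> and \<open>Q0\<close>; anticommutation forces \<open>S v = 0\<close> modulo \<open>p\<close>.\<close>
lemma Q_R_if_Q0_R:
  assumes odd: "(2::rat) \<notin> P" and det_p: "det W \<in> P" "det W / of_int p \<notin> P"
    and Q0: "Q0 \<in> carrier_mat n n" "transpose_mat Q0 * Q0 = 1\<^sub>m n" "Q0 *\<^sub>v e = e"
      "transpose_mat Q0 * S * Q0 = - S" "mat_in R Q0"
  shows "mat_in R Q"
proof (rule ccontr)
  assume "\<not> mat_in R Q"
  then obtain i j where ij: "i < n" "j < n" "Q $$ (i,j) \<notin> R" by (auto simp: mat_in_def)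
  have det_pR: "det W / of_int p \<in> R" using det_p(1) by (simp add: loc_ideal_def)
  define y where "y = (unit_vec n j :: rat vec)"
  have y [simp]: "y \<in> carrier_vec n" and y_dim [simp]: "dim_vec y = n" by (simp_all add: y_def)
  have yR: "vec_in R y" by (auto simp: y_def vec_in_def unit_vec_def)
  define q where "q = Q *\<^sub>v y"
  have q [simp]: "q \<in> carrier_vec n" by (simp add: q_def mult_mat_vec_carrier[OF Q])
  have q_col: "q = col Q j" unfolding q_def y_def using ij by (intro eq_vecI) auto
  \<comment> \<open>Entry \<open>i\<close> of the column \<open>q\<close> is not integral but
    becomes so after scaling by \<open>p\<close>; hence \<open>v\<close> is integral and
    \<open>v $ i\<close> is a unit.\<close>
  define v where "v = of_int p \<cdot>\<^sub>v q"
  have v [simp]: "v \<in> carrier_vec n" by (simp add: v_def)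
  have v_dim [simp]: "dim_vec v = n" using carrier_vecD[OF v] .
  have vR: "vec_in R v" unfolding vec_in_def
    using p_Q_R[OF det_pR det_p(2)] ij by (auto simp: v_def q_col)
  have vi: "v $ i \<notin> P" using ij by (auto simp: v_def q_col loc_ideal_def)
  have viR: "v $ i \<in> R" using vR ij v by (auto simp: vec_in_def)

  have null: "vec_in P (transpose_mat W *\<^sub>v (of_int p \<cdot>\<^sub>v (Q *\<^sub>v z)))"
    if "z \<in> carrier_vec n" "vec_in R z" for z
  proof -
    have "vec_in R (transpose_mat B.W *\<^sub>v z)" by (rule mult_mat_vec_R[OF BWTR that(2)]) (use that in auto)
    moreover have "transpose_mat W *\<^sub>v (of_int p \<cdot>\<^sub>v (Q *\<^sub>v z)) = of_int p \<cdot>\<^sub>v (transpose_mat B.W *\<^sub>v z)"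
      using that W_transpose_Q[of z] mult_mat_vec[of "transpose_mat W" n n "Q *\<^sub>v z" "of_int p"]
      by (simp add: mult_mat_vec_carrier[OF Q])
    ultimately show ?thesis by (auto simp: vec_in_def loc_ideal_def)
  qed
  have Wv: "vec_in P (transpose_mat W *\<^sub>v v)" unfolding v_def q_def by (rule null[OF y yR])
  have Sv: "S *\<^sub>v v = of_int p \<cdot>\<^sub>v (Q *\<^sub>v (T *\<^sub>v y))"
    unfolding v_def q_def using mult_mat_vec[OF S, of "Q *\<^sub>v y" "of_int p"]
    by (simp add: S_Q_vec mult_mat_vec_carrier[OF Q])
  have WSv: "vec_in P (transpose_mat W *\<^sub>v (S *\<^sub>v v))" unfolding Sv
    by (rule null) (auto simp: mult_mat_vec_carrier[OF B.S] intro!: mult_mat_vec_R[OF TR yR])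
  have Svc [simp]: "S *\<^sub>v v \<in> carrier_vec n" by (rule mult_mat_vec_carrier[OF S v])
  have SvR: "vec_in R (S *\<^sub>v v)" by (rule mult_mat_vec_R[OF SR vR]) simp
  have vv: "v \<bullet> v = of_int p * of_int p"
  proof -
    have "q \<bullet> q = 1" unfolding q_def scalar_prod_orthogonal[OF Q orth y y] using ij by (simp add: y_def)
    then show ?thesis by (simp add: v_def smult_scalar_prod_distrib[of q n] scalar_prod_smult_distrib[of _ n])
  qed
  have vSv: "v \<bullet> (S *\<^sub>v v) = 0"
    using S_adjoint[OF v v] comm_scalar_prod[OF v Svc] by simp

  \<comment> \<open>Together with \<open>null_W\<close> this describes the lattice
    \<open>W R^n\<close> as the integral vectors whose product with \<open>v\<close> lies in
    \<open>P\<close>.\<close>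
  have solve: "vec_in R a" if "a \<in> carrier_vec n" "vec_in R (W *\<^sub>v a)" "v \<bullet> (W *\<^sub>v a) \<in> P" for a
    by (rule solve_index_p[OF W_carrier WR det_p v vR Wv ij(1) vi that])
  have null_W: "x \<bullet> (W *\<^sub>v a) \<in> P"
    if "x \<in> carrier_vec n" "vec_in P (transpose_mat W *\<^sub>v x)" "a \<in> carrier_vec n" "vec_in R a" for x a
    using scalar_prod_P[OF that(2,4)] that scalar_prod_adjoint[of "transpose_mat W" n x a] by simp
  \<comment> \<open>The left kernel of \<open>W\<close> modulo \<open>p\<close> is the line spanned
    by \<open>v\<close>. The vector \<open>u\<close> below is orthogonal to \<open>v\<close>, hence
    in \<open>W R^n\<close>, hence orthogonal modulo \<open>p\<close> to every left null vector
    \<open>x\<close>; the product is a 2 by 2 minor of \<open>v\<close> and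
    \<open>x\<close>.\<close>
  have proportional: "v $ i * x $ k - x $ i * v $ k \<in> P"
    if x: "x \<in> carrier_vec n" "vec_in P (transpose_mat W *\<^sub>v x)" and k: "k < n" for x k
  proof -
    define u where "u = v $ i \<cdot>\<^sub>v unit_vec n k - v $ k \<cdot>\<^sub>v unit_vec n i"
    have u: "u \<in> carrier_vec n" by (simp add: u_def)
    have dot: "w \<bullet> u = v $ i * w $ k - w $ i * v $ k" if "w \<in> carrier_vec n" for w
      unfolding u_def using that ij k
      by (simp add: scalar_prod_minus_distrib[of _ n] scalar_prod_smult_distrib[of _ n])
    have uR: "vec_in R u" unfolding vec_in_def u_def
      using k viR vR v by (auto simp: vec_in_def unit_vec_def intro!: R_diff R_uminus)
    obtain a where a: "a \<in> carrier_vec n" "W *\<^sub>v a = u"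
      using mult_mat_vec_inverse_exists[OF W_carrier det_W u] .
    have "vec_in R a" by (rule solve) (use a uR dot[OF v] in auto)
    from null_W[OF x a(1) this] show ?thesis unfolding a(2) dot[OF x(1)] .
  qed

  have Sv0: "vec_in P (S *\<^sub>v v)"
  proof -
    \<comment> \<open>The eigenvalues of \<open>Q0\<close> and \<open>S\<close> on \<open>v\<close>
      modulo \<open>p\<close> are \<open>s / v $ i\<close> and \<open>mu / v $ i\<close>; the common
      denominator is kept cleared.\<close>
    define s where "s = (Q0 *\<^sub>v v) $ i"
    define mu where "mu = (S *\<^sub>v v) $ i"
    note Q0c = mult_mat_vec_carrier[OF Q0(1)]
    have Q0v [simp]: "Q0 *\<^sub>v v \<in> carrier_vec n" by (rule Q0c[OF v])
    have Q0vR: "vec_in R (Q0 *\<^sub>v v)" by (rule mult_mat_vec_R[OF Q0(5) vR]) (use Q0 in auto)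
    have sR: "s \<in> R" and muR: "mu \<in> R"
      using vec_inD[OF Q0vR Q0v ij(1)] vec_inD[OF SvR Svc ij(1)] by (simp_all add: s_def mu_def)
    have mS: "- S \<in> carrier_mat n n" by simp
    have SQ0: "S * Q0 = Q0 * (- S)" by (rule orthogonal_conj_commute[OF Q0(1,2) S Q0(4)])
    have anti: "S *\<^sub>v (Q0 *\<^sub>v x) = - (Q0 *\<^sub>v (S *\<^sub>v x))" if x: "x \<in> carrier_vec n" for x
    proof -
      have Sx: "S *\<^sub>v x \<in> carrier_vec n" by (rule mult_mat_vec_carrier[OF S x])
      have "S *\<^sub>v (Q0 *\<^sub>v x) = Q0 *\<^sub>v (- S *\<^sub>v x)"
        using assoc_mult_mat_vec[OF S Q0(1) x] assoc_mult_mat_vec[OF Q0(1) mS x] SQ0 by simp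
      also have "- S *\<^sub>v x = (-1) \<cdot>\<^sub>v (S *\<^sub>v x)"
        using x by (intro eq_vecI) (auto simp: uminus_mult_mat_vec)
      also have "Q0 *\<^sub>v \<dots> = (-1) \<cdot>\<^sub>v (Q0 *\<^sub>v (S *\<^sub>v x))" by (rule mult_mat_vec[OF Q0(1) Sx])
      also have "\<dots> = - (Q0 *\<^sub>v (S *\<^sub>v x))" using Q0 by (intro eq_vecI) auto
      finally show ?thesis .
    qed
    \<comment> \<open>The locale asks only for integrality and skew-symmetry, so it also covers
      \<open>- S\<close>.\<close>
    interpret M: skew_walk n "- S" e
      by unfold_locales (use skew S_Ints e_def in \<open>auto simp: mat_in_def transpose_uminus\<close>)
    interpret C: skew_conj n S e "- S" Q0
      by unfold_locales (use Q0 in auto)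
    have pow: "(- S) ^\<^sub>m k *\<^sub>v e = (-1) ^ k \<cdot>\<^sub>v (S ^\<^sub>m k *\<^sub>v e)" for k
    proof (induction k)
      case 0
      then show ?case by simp
    next
      case (Suc k)
      have "(- S) ^\<^sub>m Suc k *\<^sub>v e = - S *\<^sub>v ((-1) ^ k \<cdot>\<^sub>v (S ^\<^sub>m k *\<^sub>v e))"
        unfolding M.S_pow_Suc[symmetric] Suc ..
      also have "\<dots> = (-1) ^ k \<cdot>\<^sub>v (- S *\<^sub>v (S ^\<^sub>m k *\<^sub>v e))" by (rule mult_mat_vec[OF mS Se_carrier])
      also have "- S *\<^sub>v (S ^\<^sub>m k *\<^sub>v e) = - (S ^\<^sub>m Suc k *\<^sub>v e)"
        unfolding S_pow_Suc[symmetric] using carrier_vecD[OF Se_carrier] by (intro uminus_mult_mat_vec) simp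
      also have "(-1) ^ k \<cdot>\<^sub>v \<dots> = (-1) ^ Suc k \<cdot>\<^sub>v (S ^\<^sub>m Suc k *\<^sub>v e)" by (intro eq_vecI) auto
      finally show ?case .
    qed
    \<comment> \<open>\<open>Q0\<close> carries the walk vectors of \<open>- S\<close> to those of
      \<open>S\<close>, and the two families differ only by signs. So \<open>Q0 v\<close> is again a
      left null vector of \<open>W\<close> modulo \<open>p\<close>.\<close>
    have "vec_in P (transpose_mat W *\<^sub>v (Q0 *\<^sub>v v))"
      unfolding vec_in_def
    proof (intro allI impI)
      fix k assume "k < dim_vec (transpose_mat W *\<^sub>v (Q0 *\<^sub>v v))"
      then have k: "k < n" by simp
      have "(transpose_mat W *\<^sub>v (Q0 *\<^sub>v v)) $ k = ((- S) ^\<^sub>m k *\<^sub>v e) \<bullet> v"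
        using W_transpose_index[OF Q0v k] C.walk_scalar_prod[OF v] by simp
      also have "\<dots> = (-1) ^ k * (transpose_mat W *\<^sub>v v) $ k"
        unfolding pow W_transpose_index[OF v k] by (rule smult_scalar_prod_distrib[OF Se_carrier v])
      also have "\<dots> \<in> P"
        using P_mult_left[OF R_of_int[of "(-1)^k"] vec_inD[OF Wv mult_mat_vec_carrier[of _ n n] k]] by simp
      finally show "(transpose_mat W *\<^sub>v (Q0 *\<^sub>v v)) $ k \<in> P" .
    qed
    note pS = proportional[OF Svc WSv] and pQ = proportional[OF Q0v this]
    define d where "d = v $ i \<cdot>\<^sub>v (Q0 *\<^sub>v v) - s \<cdot>\<^sub>v v"
    define d' where "d' = v $ i \<cdot>\<^sub>v (S *\<^sub>v v) - mu \<cdot>\<^sub>v v"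
    have d: "d \<in> carrier_vec n" "d' \<in> carrier_vec n" by (simp_all add: d_def d'_def)
    have dP: "vec_in P d" "vec_in P d'"
      using pS pQ by (auto simp: vec_in_def d_def d'_def s_def mu_def simp del: index_mult_mat_vec)
    have "(S *\<^sub>v d) $ i \<in> P" "(Q0 *\<^sub>v d') $ i \<in> P"
      using vec_inD[OF mult_mat_vec_P[OF SR dP(1)] mult_mat_vec_carrier[OF S d(1)] ij(1)]
        vec_inD[OF mult_mat_vec_P[OF Q0(5) dP(2)] Q0c[OF d(2)] ij(1)] Q0(1) d by auto
    moreover have "(S *\<^sub>v d) $ i = v $ i * (S *\<^sub>v (Q0 *\<^sub>v v)) $ i - s * mu"
      unfolding d_def mu_def using mult_minus_distrib_mat_vec[OF S, of "v $ i \<cdot>\<^sub>v (Q0 *\<^sub>v v)" "s \<cdot>\<^sub>v v"]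
        mult_mat_vec[OF S Q0v] mult_mat_vec[OF S v] ij Svc by (simp del: index_mult_mat_vec)
    moreover have "(Q0 *\<^sub>v d') $ i = v $ i * (Q0 *\<^sub>v (S *\<^sub>v v)) $ i - mu * s"
      unfolding d'_def s_def using mult_minus_distrib_mat_vec[OF Q0(1), of "v $ i \<cdot>\<^sub>v (S *\<^sub>v v)" "mu \<cdot>\<^sub>v v"]
        mult_mat_vec[OF Q0(1) Svc] mult_mat_vec[OF Q0(1) v] ij Q0(1) by (simp del: index_mult_mat_vec)
    moreover have "(S *\<^sub>v (Q0 *\<^sub>v v)) $ i = - ((Q0 *\<^sub>v (S *\<^sub>v v)) $ i)"
      unfolding anti[OF v] using ij Q0(1) by (simp del: index_mult_mat_vec)
    \<comment> \<open>Adding entry \<open>i\<close> of \<open>S d\<close> and of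
      \<open>Q0 d'\<close>: anticommutation cancels the terms with both matrices applied to
      \<open>v\<close>, leaving \<open>- 2 * s * mu\<close>.\<close>
    ultimately have "(- (v $ i * (Q0 *\<^sub>v (S *\<^sub>v v)) $ i) - s * mu) + (v $ i * (Q0 *\<^sub>v (S *\<^sub>v v)) $ i - mu * s) \<in> P"
      by (intro P_add) (simp_all del: index_mult_mat_vec)
    then have "- (2 * (s * mu)) \<in> P" by (simp del: index_mult_mat_vec add: algebra_simps)
    from P_uminus[OF this] have "2 * (s * mu) \<in> P" by simp
    moreover have "2 \<in> R" using R_of_int[of 2] by simp
    ultimately have "s \<in> P \<or> mu \<in> P"
      using odd P_prime[of 2 "s * mu"] P_prime[OF sR muR] R_mult[OF sR muR] by blast
    have cancel: "vec_in P x" if "x \<in> carrier_vec n" "vec_in R x" "x $ i \<in> P"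
      "\<And>k. k < n \<Longrightarrow> v $ i * x $ k - x $ i * v $ k \<in> P" for x
      unfolding vec_in_def
    proof (intro allI impI)
      fix k assume "k < dim_vec x"
      then have k: "k < n" using that by simp
      have "v $ i * x $ k - x $ i * v $ k + x $ i * v $ k \<in> P"
        by (rule P_add[OF that(4)[OF k] P_mult_right[OF that(3) vec_inD[OF vR v k]]])
      then show "x $ k \<in> P" using P_prime[OF viR vec_inD[OF that(2,1) k]] vi by simp
    qed
    \<comment> \<open>An integral orthogonal matrix is invertible over \<open>R\<close>, so
      \<open>Q0\<close> cannot annihilate \<open>v\<close> modulo \<open>p\<close>.\<close>
    have "s \<notin> P"
    proof
      assume "s \<in> P"
      then have "vec_in P (Q0 *\<^sub>v v)" using cancel[OF Q0v Q0vR _ pQ] by (simp add: s_def del: index_mult_mat_vec)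
      then have "vec_in P (transpose_mat Q0 *\<^sub>v (Q0 *\<^sub>v v))"
        by (rule mult_mat_vec_P[OF mat_in_transpose[OF Q0(5)]]) (use Q0(1) in auto)
      moreover have "transpose_mat Q0 *\<^sub>v (Q0 *\<^sub>v v) = v"
        using assoc_mult_mat_vec[of "transpose_mat Q0" n n Q0 n v] Q0 by simp
      ultimately show False using vec_inD[OF _ v ij(1)] vi by metis
    qed
    with \<open>s \<in> P \<or> mu \<in> P\<close> show ?thesis
      using cancel[OF Svc SvR _ pS] by (simp add: mu_def del: index_mult_mat_vec)
  qed

  have n': "0 < n" using ij by auto
  let ?sh = "\<lambda>c a. vec n (\<lambda>j. (if j = 0 then 0 else a $ (j - 1)) + a $ (n - 1) * c $ j)"
  have inv: "\<exists>a\<in>carrier_vec n. W *\<^sub>v a = u" if "u \<in> carrier_vec n" for u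
    using mult_mat_vec_inverse_exists[OF W_carrier det_W that] by blast
  obtain c where c: "c \<in> carrier_vec n" "W *\<^sub>v c = S ^\<^sub>m n *\<^sub>v e" using inv[OF Se_carrier] by blast
  obtain a where a: "a \<in> carrier_vec n" "W *\<^sub>v a = v" using inv[OF v] by blast
  \<comment> \<open>\<open>w\<close> lies outside \<open>W R^n\<close>, since
    \<open>v . w = v $ i\<close> is a unit. Thus \<open>p w\<close> represents the line coming from
    R^n, as \<open>v\<close> represents the one coming from Q R^n.\<close>
  define w where "w = (unit_vec n i :: rat vec)"
  have w [simp]: "w \<in> carrier_vec n" and w_dim [simp]: "dim_vec w = n" by (simp_all add: w_def)
  have wR: "vec_in R w" by (auto simp: w_def vec_in_def unit_vec_def)
  have pw: "of_int p \<cdot>\<^sub>v w \<in> carrier_vec n" by simp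
  have Swc: "S *\<^sub>v w \<in> carrier_vec n" by (rule mult_mat_vec_carrier[OF S w])
  obtain b where b: "b \<in> carrier_vec n" "W *\<^sub>v b = of_int p \<cdot>\<^sub>v w" using inv[OF pw] by blast
  have dotw: "x \<bullet> w = x $ i" if "x \<in> carrier_vec n" for x
    unfolding w_def using that ij by simp
  \<comment> \<open>Integrality of the recurrence for \<open>S^n e\<close> comes from the membership
    test: \<open>v . (S^n e)\<close> equals \<open>p\<close> times the integral number
    \<open>(T^n e) . y\<close>.\<close>
  have cR: "vec_in R c"
  proof (rule solve[OF c(1)])
    have "v \<bullet> (S ^\<^sub>m n *\<^sub>v e) = of_int p * ((T ^\<^sub>m n *\<^sub>v e) \<bullet> y)"
      using walk_scalar_prod[OF y, of n] comm_scalar_prod[OF v Se_carrier]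
        scalar_prod_smult_distrib[OF Se_carrier q] by (simp add: v_def q_def)
    moreover have "(T ^\<^sub>m n *\<^sub>v e) \<bullet> y \<in> R" by (rule scalar_prod_R[OF powR(2) yR]) simp
    ultimately show "v \<bullet> (W *\<^sub>v c) \<in> P" unfolding c(2) by (simp add: loc_ideal_def)
  qed (simp add: c(2) powR)
  \<comment> \<open>\<open>v\<close> passes the membership test because the columns of
    \<open>Q\<close> have norm 1, so \<open>v . v = p^2\<close>.\<close>
  have aR: "vec_in R a"
    by (rule solve[OF a(1)]) (use vR in \<open>simp_all add: a(2) vv loc_ideal_def\<close>)
  have bR: "vec_in R b"
  proof (rule solve[OF b(1)])
    show "vec_in R (W *\<^sub>v b)" unfolding b(2) using wR by (auto simp: vec_in_def intro!: R_mult)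
    show "v \<bullet> (W *\<^sub>v b) \<in> P"
      unfolding b(2) using scalar_prod_smult_distrib[OF v w] dotw[OF v] viR by (simp add: loc_ideal_def)
  qed
  \<comment> \<open>If \<open>S\<close> sends \<open>W x\<close> into \<open>p W R^n\<close>, then
    the coordinate vector \<open>x\<close> lies in the kernel of the companion matrix modulo
    \<open>p\<close>.\<close>
  have shP: "vec_in P (?sh c x)"
    if x: "x \<in> carrier_vec n" and z: "z \<in> carrier_vec n" "S *\<^sub>v (W *\<^sub>v x) = of_int p \<cdot>\<^sub>v z"
      "vec_in R z" "v \<bullet> z \<in> P" for x z
  proof -
    have s: "?sh c x \<in> carrier_vec n" by simp
    have "W *\<^sub>v ((1 / of_int p) \<cdot>\<^sub>v ?sh c x) = (1 / of_int p) \<cdot>\<^sub>v (W *\<^sub>v ?sh c x)"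
      by (rule mult_mat_vec[OF W_carrier s])
    also have "W *\<^sub>v ?sh c x = of_int p \<cdot>\<^sub>v z" using S_W_shift[OF x c n'] z(2) by simp
    also have "(1 / of_int p) \<cdot>\<^sub>v \<dots> = z" by (intro eq_vecI) auto
    finally have eq: "W *\<^sub>v ((1 / of_int p) \<cdot>\<^sub>v ?sh c x) = z" .
    have "vec_in R ((1 / of_int p) \<cdot>\<^sub>v ?sh c x)" by (rule solve, simp) (simp_all only: eq z)
    then show ?thesis by (auto simp: vec_in_def loc_ideal_def)
  qed
  have shaP: "vec_in P (?sh c a)"
  proof (rule shP[OF a(1)])
    let ?z = "(1 / of_int p) \<cdot>\<^sub>v (S *\<^sub>v v)"
    show "S *\<^sub>v (W *\<^sub>v a) = of_int p \<cdot>\<^sub>v ?z" unfolding a(2) by (intro eq_vecI) auto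
    show "vec_in R ?z" using Sv0 by (auto simp: vec_in_def loc_ideal_def)
    \<comment> \<open>Skew-symmetry makes \<open>v . (S v)\<close> exactly zero, so dividing by
      \<open>p\<close> does no harm.\<close>
    show "v \<bullet> ?z \<in> P" using scalar_prod_smult_distrib[OF v Svc] vSv by simp
  qed simp
  have shbP: "vec_in P (?sh c b)"
  proof (rule shP[OF b(1) Swc])
    show "S *\<^sub>v (W *\<^sub>v b) = of_int p \<cdot>\<^sub>v (S *\<^sub>v w)" unfolding b(2) by (rule mult_mat_vec[OF S w])
    show "vec_in R (S *\<^sub>v w)" by (rule mult_mat_vec_R[OF SR wR]) simp
    have "v \<bullet> (S *\<^sub>v w) = - ((S *\<^sub>v v) $ i)" using S_adjoint[OF v w] dotw[OF Svc] by simp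
    then show "v \<bullet> (S *\<^sub>v w) \<in> P" using P_uminus[OF vec_inD[OF Sv0 Svc ij(1)]] by metis
  qed
  define \<alpha> where "\<alpha> = a $ (n - 1)"
  define \<beta> where "\<beta> = b $ (n - 1)"
  have last: "n - 1 < n" using n' by simp
  have \<alpha>R: "\<alpha> \<in> R" and \<beta>R: "\<beta> \<in> R"
    using vec_inD[OF aR a(1) last] vec_inD[OF bR b(1) last] by (simp_all add: \<alpha>_def \<beta>_def)
  \<comment> \<open>Entry \<open>Suc k\<close> of the shifted vector expresses coordinate
    \<open>k\<close> through the last coordinate: a kernel vector modulo \<open>p\<close> is
    determined by its last entry.\<close>
  have sa: "a $ k + \<alpha> * c $ Suc k \<in> P" and sb: "b $ k + \<beta> * c $ Suc k \<in> P" if "Suc k < n" for k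
    using vec_inD[OF shaP _ that] vec_inD[OF shbP _ that] that by (simp_all add: \<alpha>_def \<beta>_def)
  have split: "k = n - 1 \<or> Suc k < n" if "k < n" for k using that by linarith
  have \<alpha>: "\<alpha> \<notin> P"
  proof
    assume \<alpha>P: "\<alpha> \<in> P"
    have "a $ k \<in> P" if k: "k < n" for k
      using split[OF k]
    proof
      assume k: "Suc k < n"
      have "a $ k + \<alpha> * c $ Suc k - \<alpha> * c $ Suc k \<in> P"
        by (rule P_diff[OF sa[OF k] P_mult_right[OF \<alpha>P vec_inD[OF cR c(1) k]]])
      then show ?thesis by simp
    qed (use \<alpha>P in \<open>simp add: \<alpha>_def\<close>)
    then have "vec_in P a" using a by (auto simp: vec_in_def)
    then have "vec_in P (W *\<^sub>v a)" by (rule mult_mat_vec_P[OF WR]) (use a in simp)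
    then show False using vec_inD[OF _ v ij(1)] vi unfolding a(2) by blast
  qed
  \<comment> \<open>In \<open>\<beta> a - \<alpha> b\<close> the last coordinates cancel, so by the
    previous observation the whole combination vanishes modulo \<open>p\<close> and can be divided
    by \<open>p\<close>.\<close>
  define t where "t = (1 / of_int p) \<cdot>\<^sub>v (\<beta> \<cdot>\<^sub>v a - \<alpha> \<cdot>\<^sub>v b)"
  have t: "t \<in> carrier_vec n" using a b by (simp add: t_def)
  have tR: "vec_in R t"
    unfolding vec_in_def
  proof (intro allI impI)
    fix k assume "k < dim_vec t"
    then have k: "k < n" using t by simp
    have "\<beta> * a $ k - \<alpha> * b $ k \<in> P"
      using split[OF k]
    proof
      assume k: "Suc k < n"
      have "\<beta> * (a $ k + \<alpha> * c $ Suc k) - \<alpha> * (b $ k + \<beta> * c $ Suc k) \<in> P"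
        by (intro P_diff P_mult_left \<alpha>R \<beta>R sa sb k)
      then show ?thesis by (simp add: algebra_simps)
    qed (simp add: \<alpha>_def \<beta>_def)
    then show "t $ k \<in> R" using k a b by (simp add: t_def loc_ideal_def)
  qed
  have Wt: "W *\<^sub>v t = (1 / of_int p) \<cdot>\<^sub>v (\<beta> \<cdot>\<^sub>v v - \<alpha> \<cdot>\<^sub>v (of_int p \<cdot>\<^sub>v w))"
    unfolding t_def using a b mult_mat_vec[OF W_carrier, of "\<beta> \<cdot>\<^sub>v a - \<alpha> \<cdot>\<^sub>v b" "1 / of_int p"]
      mult_minus_distrib_mat_vec[OF W_carrier, of "\<beta> \<cdot>\<^sub>v a" "\<alpha> \<cdot>\<^sub>v b"]
      mult_mat_vec[OF W_carrier a(1)] mult_mat_vec[OF W_carrier b(1)] by simp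
  have "(W *\<^sub>v t) $ i \<in> R"
    by (rule vec_inD[OF mult_mat_vec_R[OF WR tR] mult_mat_vec_carrier[OF W_carrier t] ij(1)]) (use t in simp)
  moreover have "(W *\<^sub>v t) $ i = \<beta> * v $ i / of_int p - \<alpha>"
    unfolding Wt using ij v by (simp add: w_def field_simps del: v)
  ultimately have "\<beta> * v $ i / of_int p - \<alpha> + \<alpha> \<in> R" using R_add[OF _ \<alpha>R] by metis
  then have "\<beta> * v $ i \<in> P" by (simp add: loc_ideal_def)
  then have "\<beta> \<in> P" using P_prime[OF \<beta>R viR] vi by blast
  then have \<beta>': "\<beta> / of_int p \<in> R" by (simp add: loc_ideal_def)
  \<comment> \<open>\<open>W t\<close> must pass the membership test. With
    \<open>v . v = p^2\<close> and \<open>v . w = v $ i\<close>, the product is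
    \<open>\<alpha> v $ i\<close> up to sign and a multiple of \<open>p\<close>, whereas both
    factors are units.\<close>
  have "v \<bullet> (W *\<^sub>v t) = (1 / of_int p) * (\<beta> * (v \<bullet> v) - \<alpha> * (of_int p * (v \<bullet> w)))"
    unfolding Wt using v w by (simp add: scalar_prod_minus_distrib[of _ n] scalar_prod_smult_distrib[of _ n] del: v w)
  also have "\<dots> = of_int p * \<beta> - \<alpha> * v $ i"
    unfolding vv dotw[OF v] by (simp add: field_simps)
  finally have "of_int p * \<beta> - \<alpha> * v $ i \<in> P" using null_W[OF v Wv t tR] by simp
  moreover have "of_int p * \<beta> \<in> P" using \<beta>R by (simp add: loc_ideal_def)
  ultimately have "of_int p * \<beta> - (of_int p * \<beta> - \<alpha> * v $ i) \<in> P" by (rule P_diff[rotated])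
  then have "\<alpha> * v $ i \<in> P" by simp
  then show False using P_prime[OF \<alpha>R viR] \<alpha> vi by blast
qed

end

section \<open>The prime 2\<close>

lemma det_mat_diag: "det (mat_diag n f) = (\<Prod>i<n. f i)"
proof -
  have "det (mat_diag n f) = prod_list (diag_mat (mat_diag n f))"
    by (rule det_upper_triangular[of _ n]) (auto simp: mat_diag_def)
  then show ?thesis
    by (simp add: prod_list_diag_prod mat_diag_def atLeast0LessThan)
qed

context prime_localization begin

text \<open>The residue field at 2 has two elements, so squaring is the identity on it.\<close>

lemma square_minus_self_in_P:
  assumes "p = 2" "x \<in> R" shows "x * x - x \<in> P"
proof -
  from assms obtain m b where m: "\<not> p dvd m" "of_int m * x = of_int b"
    unfolding localization_def by (auto elim!: Ints_cases)
  have "of_int (m * m) * (x * x - x) = (of_int m * x) * (of_int m * x) - of_int m * (of_int m * x)"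
    by (simp add: algebra_simps)
  also have "\<dots> = of_int (b * b - m * b)" unfolding m by simp
  also have "\<dots> \<in> P" using m assms by (intro of_int_in_P) auto
  finally have "of_int (m * m) * (x * x - x) \<in> P" .
  moreover have "\<not> p dvd m * m" using m assms by auto
  ultimately show ?thesis
    using P_prime[OF R_of_int[of "m*m"] R_diff[OF R_mult[OF assms(2,2)] assms(2)]] of_int_in_P_iff[of "m*m"]
    by blast
qed

lemma sum_in_P_if_sum_squares_in_P:
  assumes "p = 2" "\<And>i. i \<in> I \<Longrightarrow> f i \<in> R"
  shows "(\<Sum>i\<in>I. f i * f i) - (\<Sum>i\<in>I. f i) \<in> P"
  unfolding sum_subtractf[symmetric] by (intro P_sum square_minus_self_in_P assms)

end

context skew_walk begin

text \<open>Each \<open>S\<close> moved from the right factor to the left costs one sign.\<close>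

lemma W_gram_shift: "(S ^\<^sub>m i *\<^sub>v e) \<bullet> (S ^\<^sub>m j *\<^sub>v e) = (-1) ^ j * ((S ^\<^sub>m (i + j) *\<^sub>v e) \<bullet> e)"
proof (induction j arbitrary: i)
  case 0
  then show ?case by simp
next
  case (Suc j)
  have "(S ^\<^sub>m i *\<^sub>v e) \<bullet> (S ^\<^sub>m Suc j *\<^sub>v e) = - ((S ^\<^sub>m Suc i *\<^sub>v e) \<bullet> (S ^\<^sub>m j *\<^sub>v e))"
    using S_adjoint[OF Se_carrier Se_carrier, of i j] unfolding S_pow_Suc by simp
  then show ?case unfolding Suc.IH by simp
qed

end

context skew_conj_at_prime begin

text \<open>Up to sign the product depends only on \<open>N = i + j\<close>. For odd
  \<open>N\<close> symmetry and skew-symmetry make it zero. For \<open>N = 2 m\<close> it is, up to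
  sign, the sum of squares of the entries of \<open>S^m e\<close>, which modulo 2 is their sum, the
  case \<open>m < N\<close>.\<close>

lemma gram_even:
  assumes "p = 2" "0 < i + j"
  shows "(S ^\<^sub>m i *\<^sub>v e) \<bullet> (S ^\<^sub>m j *\<^sub>v e) \<in> P"
proof -
  define g where "g i j = (S ^\<^sub>m i *\<^sub>v e) \<bullet> (S ^\<^sub>m j *\<^sub>v e)" for i j
  have e0: "S ^\<^sub>m 0 *\<^sub>v e = e" by simp
  have g: "g i j = (-1) ^ j * g (i + j) 0" for i j unfolding g_def e0 by (rule W_gram_shift)
  have comm: "g i j = g j i" for i j unfolding g_def by (rule comm_scalar_prod[OF Se_carrier Se_carrier])
  have sgn: "(-1) ^ j * x \<in> P" if "x \<in> P" for x and j :: nat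
    using P_mult_left[OF R_of_int[of "(-1)^j"] that] by simp
  have "g N 0 \<in> P" if "0 < N" for N
    using that
  proof (induction N rule: less_induct)
    case (less N)
    show ?case
    proof (cases "even N")
      case True
      then obtain m where m: "N = m + m" by (metis mult_2 evenE)
      have "g m m - g m 0 \<in> P"
        using sum_in_P_if_sum_squares_in_P[OF assms(1), of "{0..<n}" "\<lambda>k. (S ^\<^sub>m m *\<^sub>v e) $ k"]
          vec_inD[OF powR(1) Se_carrier]
        unfolding g_def e0 by (auto simp: scalar_prod_def simp del: index_mult_mat_vec)
      moreover have "g m 0 \<in> P" using less m by auto
      ultimately have "g m m \<in> P" using P_add[of "g m m - g m 0" "g m 0"] by simp
      then have "(-1) ^ m * ((-1) ^ m * g N 0) \<in> P" using sgn g[of m m] m by metis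
      then show ?thesis by (simp add: mult.assoc[symmetric] power_add[symmetric])
    next
      case False
      then have "g 0 N = - g N 0" using g[of 0 N] by simp
      then have "g N 0 = 0" using comm[of 0 N] by simp
      then show ?thesis by simp
    qed
  qed
  then have "g i j \<in> P" using g[of i j] sgn assms(2) by metis
  then show ?thesis by (simp add: g_def)
qed

text \<open>The counterpart at 2 of \<open>solve_index_p\<close>: congruences for products with the
  walk vectors yield integral Krylov coordinates.\<close>

lemma gram_solve:
  assumes p: "p = 2" and det: "det W = 2 ^ (n div 2) * c" "c \<in> R" "c \<notin> P"
    and z: "z \<in> carrier_vec n" "vec_in P (transpose_mat W *\<^sub>v (W *\<^sub>v z))"
  shows "vec_in R z"
proof -
  \<comment> \<open>The (0,0) entry of the Gram matrix is \<open>n\<close>, so for odd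
    \<open>n\<close> column 0 cannot be halved. In both parities \<open>2 * (n div 2)\<close>
    columns are halved, which uses up all factors 2 of the square of \<open>det W\<close>.\<close>
  define d :: "nat \<Rightarrow> rat" where "d k = (if k = 0 \<and> odd n then 1 else 2)" for k
  have d0: "d k \<noteq> 0" for k by (simp add: d_def)
  define M where "M = transpose_mat W * W"
  have M: "M \<in> carrier_mat n n" by (simp add: M_def mult_carrier_mat[of _ n n])
  have Mij: "M $$ (i,j) = (S ^\<^sub>m i *\<^sub>v e) \<bullet> (S ^\<^sub>m j *\<^sub>v e)" if "i < n" "j < n" for i j
    using that by (simp add: M_def W_col)
  define G where "G = mat n n (\<lambda>(i,j). M $$ (i,j) / d j)"
  have G: "G \<in> carrier_mat n n" by (simp add: G_def)
  have GR: "mat_in R G"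
    unfolding mat_in_def
  proof (intro allI impI)
    fix i j assume "i < dim_row G" "j < dim_col G"
    then have ij: "i < n" "j < n" using G by auto
    have 1: "M $$ (i,j) \<in> R" unfolding Mij[OF ij] by (intro scalar_prod_R powR) simp
    have "M $$ (i,j) \<in> P" if "d j = 2"
    proof (cases "i + j = 0")
      case True
      then have "M $$ (i,j) = of_int (int n)" using Mij[OF ij] by (simp add: scalar_prod_def)
      moreover have "p dvd int n" using that True p by (auto simp: d_def split: if_splits)
      ultimately show ?thesis using of_int_in_P by metis
    qed (use gram_even[OF p] Mij[OF ij] in auto)
    then show "G $$ (i,j) \<in> R" using 1 ij p by (auto simp: G_def d_def loc_ideal_def)
  qed
  have fac: "M = G * mat_diag n d"
    unfolding mat_diag_mult_right[OF G] by (rule eq_matI) (use M d0 in \<open>auto simp: G_def\<close>)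
  have prod_d: "(\<Prod>i<n. d i) = 2 ^ (n div 2) * 2 ^ (n div 2)"
  proof (cases "odd n")
    case True
    then obtain m where m: "n = Suc (2 * m)" by (metis oddE Suc_eq_plus1)
    have "(\<Prod>i<n. d i) = d 0 * (\<Prod>i<2 * m. d (Suc i))" unfolding m by (rule prod.lessThan_Suc_shift)
    then show ?thesis using True by (simp add: d_def m mult_2 power_add)
  next
    case False
    then obtain m where m: "n = 2 * m" by (metis evenE)
    show ?thesis using False by (simp add: d_def m mult_2 power_add)
  qed
  have "det M = det W * det W"
    unfolding M_def by (subst det_mult[of _ n]) (auto simp: det_transpose[OF W_carrier])
  moreover have "det M = det G * (2 ^ (n div 2) * 2 ^ (n div 2))"
    unfolding fac by (subst det_mult[OF G]) (auto simp: det_mat_diag prod_d)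
  ultimately have "det G = c * c" unfolding det(1) by simp
  then have detG: "det G \<notin> P" using P_prime[OF det(2,2)] det(3) by auto
  \<comment> \<open>Chosen so that \<open>G x\<close> is the Gram matrix applied to
    \<open>z\<close>, divided by \<open>p\<close>. As \<open>d k\<close> divides 2, integrality of
    \<open>x\<close> passes to \<open>z\<close>.\<close>
  define x where "x = vec n (\<lambda>k. d k * z $ k / of_int p)"
  have "vec_in R (G *\<^sub>v x)"
    unfolding vec_in_def
  proof (intro allI impI)
    fix i assume "i < dim_vec (G *\<^sub>v x)"
    then have i: "i < n" using G by simp
    have "(G *\<^sub>v x) $ i = (\<Sum>k<n. M $$ (i,k) * z $ k / of_int p)"
      using mult_mat_vec_sum[OF G, of x i] i d0 by (simp add: x_def G_def)
    also have "\<dots> = (M *\<^sub>v z) $ i / of_int p"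
      using mult_mat_vec_sum[OF M z(1) i] by (simp add: sum_divide_distrib)
    also have "M *\<^sub>v z = transpose_mat W *\<^sub>v (W *\<^sub>v z)" unfolding M_def
      by (rule assoc_mult_mat_vec[of _ n n _ n]) (use z in auto)
    finally show "(G *\<^sub>v x) $ i \<in> R" using z i by (auto simp: vec_in_def loc_ideal_def simp del: index_mult_mat_vec)
  qed
  from solve_unit_det[OF G GR detG _ this] have xR: "vec_in R x" by (simp add: x_def)
  show ?thesis unfolding vec_in_def
  proof (intro allI impI)
    fix k assume "k < dim_vec z"
    then have k: "k < n" using z by simp
    then have "d k * z $ k / of_int p \<in> R" using xR by (auto simp: vec_in_def x_def)
    moreover have "of_int p / d k = of_int (if k = 0 \<and> odd n then 2 else 1)" by (simp add: d_def p)
    then have "of_int p / d k \<in> R" by (metis R_of_int)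
    ultimately have "of_int p / d k * (d k * z $ k / of_int p) \<in> R" by (intro R_mult)
    then show "z $ k \<in> R" using d0[of k] by simp
  qed
qed

text \<open>For \<open>x = 2 Q y\<close>, written as \<open>F e\<close> with \<open>F\<close> a polynomial in \<open>S\<close>, the matrix \<open>F\<^sup>T F\<close> vanishes modulo 2.
  Its diagonal shows that all row sums of \<open>F\<close> are even, that is, \<open>x\<close> is even.\<close>
lemma Q_R_at_2:
  assumes p: "p = 2" and det: "det W = 2 ^ (n div 2) * c" "c \<in> R" "c \<notin> P"
  shows "mat_in R Q"
  unfolding mat_in_def
proof (intro allI impI)
  fix i j assume "i < dim_row Q" "j < dim_col Q"
  then have ij: "i < n" "j < n" by simp_all
  define y where "y = (unit_vec n j :: rat vec)"
  have y [simp]: "y \<in> carrier_vec n" and y_dim [simp]: "dim_vec y = n" by (simp_all add: y_def)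
  have yR: "vec_in R y" by (auto simp: y_def vec_in_def unit_vec_def)
  define q where "q = Q *\<^sub>v y"
  have q [simp]: "q \<in> carrier_vec n" by (simp add: q_def mult_mat_vec_carrier[OF Q])
  define x where "x = of_int p \<cdot>\<^sub>v q"
  have x [simp]: "x \<in> carrier_vec n" and x_dim [simp]: "dim_vec x = n"
    using q by (simp_all add: x_def carrier_vecD[OF q])
  have x_i: "x $ i = of_int p * Q $$ (i,j)" using ij by (simp add: x_def q_def y_def)
  obtain a where a: "a \<in> carrier_vec n" "W *\<^sub>v a = x"
    using mult_mat_vec_inverse_exists[OF W_carrier det_W x] .
  have aR: "vec_in R a"
  proof (rule gram_solve[OF p det a(1)])
    have "vec_in R (transpose_mat B.W *\<^sub>v y)" by (rule mult_mat_vec_R[OF BWTR yR]) simp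
    moreover have "transpose_mat W *\<^sub>v x = of_int p \<cdot>\<^sub>v (transpose_mat B.W *\<^sub>v y)"
      unfolding x_def W_transpose_Q[OF y, symmetric] q_def[symmetric] by (rule mult_mat_vec[of _ n n]) auto
    ultimately show "vec_in P (transpose_mat W *\<^sub>v (W *\<^sub>v a))"
      unfolding a(2) by (auto simp: vec_in_def loc_ideal_def)
  qed
  define F where "F = mat_poly S (\<lambda>k. a $ k) n"
  have F [simp]: "F \<in> carrier_mat n n" by (simp add: F_def)
  have F_dim [simp]: "dim_row F = n" "dim_col F = n" using carrier_matD[OF F] by auto
  have Ft [simp]: "transpose_mat F \<in> carrier_mat n n" by simp
  have FR: "mat_in R F" unfolding F_def by (rule mat_poly_R[OF S SR]) (rule vec_inD[OF aR a(1)])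
  have Fe: "F *\<^sub>v e = x" unfolding F_def mat_poly_e[OF a(1)] by (rule a(2))
  have SF: "S * F = F * S" unfolding F_def by (rule mat_poly_commute[OF S S refl])
  have FtS: "transpose_mat F * S = S * transpose_mat F"
  proof -
    have "transpose_mat (S * F) = transpose_mat (F * S)" using SF by simp
    then have "transpose_mat F * (- S) = - S * transpose_mat F"
      unfolding transpose_mult[OF S F] transpose_mult[OF F S] skew .
    then have "- (transpose_mat F * S) = - (S * transpose_mat F)" by simp
    then show ?thesis by (metis uminus_uminus_mat)
  qed
  have FtF: "transpose_mat F * F = F * transpose_mat F"
    unfolding F_def by (rule mat_poly_commute[OF S]) (use FtS in \<open>simp_all add: F_def[symmetric]\<close>)
  let ?K = "transpose_mat F * F"
  have K: "?K \<in> carrier_mat n n" by (rule mult_carrier_mat[OF Ft F])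
  have KS: "?K * S = S * ?K"
    using assoc_mult_mat[OF Ft F S] assoc_mult_mat[OF Ft S F] assoc_mult_mat[OF S Ft F] SF FtS by simp
  have Ke: "?K *\<^sub>v e \<in> carrier_vec n" by (rule mult_mat_vec_carrier[OF K]) simp
  obtain b where b: "b \<in> carrier_vec n" "W *\<^sub>v b = ?K *\<^sub>v e"
    using mult_mat_vec_inverse_exists[OF W_carrier det_W Ke] .
  \<comment> \<open>These are the coordinates of half of \<open>F^T F e\<close>. Their integrality
    is what makes \<open>F^T F\<close> twice an integral polynomial in \<open>S\<close>.\<close>
  define h where "h = (1 / of_int p) \<cdot>\<^sub>v b"
  have h: "h \<in> carrier_vec n" using b by (simp add: h_def)
  have Wh: "W *\<^sub>v h = (1 / of_int p) \<cdot>\<^sub>v (?K *\<^sub>v e)"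
    unfolding h_def b(2)[symmetric] by (rule mult_mat_vec[OF W_carrier b(1)])
  have hR: "vec_in R h"
  proof (rule gram_solve[OF p det h])
    \<comment> \<open>Moving \<open>F^T\<close> across and commuting \<open>F\<close> with
      \<open>S^k\<close> gives \<open>(S^k x) . x / p\<close>. Each \<open>x\<close> carries a
      factor \<open>p\<close>, so one survives the division.\<close>
    have "(transpose_mat W *\<^sub>v (W *\<^sub>v h)) $ k \<in> P" if k: "k < n" for k
    proof -
      have Sk: "S ^\<^sub>m k \<in> carrier_mat n n" by simp
      have "(transpose_mat W *\<^sub>v (W *\<^sub>v h)) $ k = (S ^\<^sub>m k *\<^sub>v e) \<bullet> (?K *\<^sub>v e) / of_int p"
        unfolding Wh using W_transpose_index[of "(1 / of_int p) \<cdot>\<^sub>v (?K *\<^sub>v e)" k] k Ke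
          scalar_prod_smult_distrib[OF Se_carrier Ke] by simp
      also have "?K *\<^sub>v e = transpose_mat F *\<^sub>v x"
        unfolding Fe[symmetric] by (rule assoc_mult_mat_vec[OF Ft F]) simp
      also have "(S ^\<^sub>m k *\<^sub>v e) \<bullet> (transpose_mat F *\<^sub>v x) = (F *\<^sub>v (S ^\<^sub>m k *\<^sub>v e)) \<bullet> x"
        by (rule scalar_prod_adjoint[OF F Se_carrier x, symmetric])
      also have "F *\<^sub>v (S ^\<^sub>m k *\<^sub>v e) = S ^\<^sub>m k *\<^sub>v x"
        unfolding Fe[symmetric] using pow_mat_commute[OF S F SF[symmetric], of k]
          assoc_mult_mat_vec[OF Sk F, of e] assoc_mult_mat_vec[OF F Sk, of e] by simp
      also have "\<dots> = of_int p \<cdot>\<^sub>v (Q *\<^sub>v (T ^\<^sub>m k *\<^sub>v y))"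
        unfolding x_def q_def S_pow_Q_vec[OF y, symmetric]
        by (rule mult_mat_vec[OF Sk]) (simp add: q_def[symmetric])
      also have "\<dots> \<bullet> x = of_int p * of_int p * ((T ^\<^sub>m k *\<^sub>v y) \<bullet> y)"
      proof -
        have Ty: "T ^\<^sub>m k *\<^sub>v y \<in> carrier_vec n" by (rule mult_mat_vec_carrier[of _ n n]) auto
        show ?thesis unfolding x_def
          using smult_scalar_prod_distrib[OF mult_mat_vec_carrier[OF Q Ty], of "of_int p \<cdot>\<^sub>v q" "of_int p"]
            scalar_prod_smult_distrib[OF mult_mat_vec_carrier[OF Q Ty] q, of "of_int p"]
            scalar_prod_orthogonal[OF Q orth Ty y] by (simp add: q_def[symmetric] del: B.S)
      qed
      finally have "(transpose_mat W *\<^sub>v (W *\<^sub>v h)) $ k = of_int p * ((T ^\<^sub>m k *\<^sub>v y) \<bullet> y)" by simp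
      moreover have "(T ^\<^sub>m k *\<^sub>v y) \<bullet> y \<in> R"
        by (intro scalar_prod_R mult_mat_vec_R pow_mat_R[OF B.S TR] yR) auto
      ultimately show ?thesis by (simp add: loc_ideal_def)
    qed
    then show "vec_in P (transpose_mat W *\<^sub>v (W *\<^sub>v h))" by (simp add: vec_in_def del: index_mult_mat_vec)
  qed
  define H where "H = mat_poly S (\<lambda>k. h $ k) n"
  have H [simp]: "H \<in> carrier_mat n n" by (simp add: H_def)
  have HR: "mat_in R H" unfolding H_def by (rule mat_poly_R[OF S SR]) (rule vec_inD[OF hR h])
  have HS: "H * S = S * H" unfolding H_def by (rule mat_poly_commute[OF S S refl, symmetric])
  have He: "H *\<^sub>v e = (1 / of_int p) \<cdot>\<^sub>v (?K *\<^sub>v e)" unfolding H_def mat_poly_e[OF h] by (rule Wh)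
  have pH: "of_int p \<cdot>\<^sub>m H \<in> carrier_mat n n" by simp
  \<comment> \<open>Both matrices commute with \<open>S\<close> and agree on \<open>e\<close>, so
    they agree on all walk vectors, the columns of the invertible matrix \<open>W\<close>.\<close>
  have "?K * W = (of_int p \<cdot>\<^sub>m H) * W"
  proof (intro mat_col_eqI)
    fix k assume "k < dim_col (of_int p \<cdot>\<^sub>m H * W)"
    then have k: "k < n" by simp
    have Sk: "S ^\<^sub>m k \<in> carrier_mat n n" by simp
    have "col (?K * W) k = ?K *\<^sub>v (S ^\<^sub>m k *\<^sub>v e)" using k K W_col by (simp add: col_mult2[OF K W_carrier])
    also have "\<dots> = S ^\<^sub>m k *\<^sub>v (?K *\<^sub>v e)"
      using pow_mat_commute[OF S K KS, of k] assoc_mult_mat_vec[OF Sk K, of e] assoc_mult_mat_vec[OF K Sk, of e]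
      by simp
    also have "?K *\<^sub>v e = of_int p \<cdot>\<^sub>v (H *\<^sub>v e)" unfolding He by (intro eq_vecI) auto
    also have "\<dots> = (of_int p \<cdot>\<^sub>m H) *\<^sub>v e" by (rule smult_mat_mult_vec[OF H, symmetric]) simp
    also have "S ^\<^sub>m k *\<^sub>v \<dots> = (of_int p \<cdot>\<^sub>m H) *\<^sub>v (S ^\<^sub>m k *\<^sub>v e)"
    proof -
      have "(of_int p \<cdot>\<^sub>m H) * S = S * (of_int p \<cdot>\<^sub>m H)"
        using mult_smult_distrib[OF S H] mult_smult_assoc_mat[OF H S] HS by simp
      from pow_mat_commute[OF S pH this, of k] show ?thesis
        using assoc_mult_mat_vec[OF Sk pH, of e] assoc_mult_mat_vec[OF pH Sk, of e] by simp
    qed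
    also have "\<dots> = col ((of_int p \<cdot>\<^sub>m H) * W) k" using k W_col by (simp add: col_mult2[OF pH W_carrier])
    finally show "col (?K * W) k = col ((of_int p \<cdot>\<^sub>m H) * W) k" .
  qed (use carrier_matD[OF H] in simp_all)
  then have "?K = of_int p \<cdot>\<^sub>m H" by (rule right_cancel_mat[OF W_carrier det_W K pH])
  \<comment> \<open>The order of the factors is switched because the relevant sums run along rows:
    \<open>F e = x\<close> makes \<open>x $ i\<close> the sum of row \<open>i\<close> of
    \<open>F\<close>.\<close>
  then have "(F * transpose_mat F) $$ (i,i) = of_int p * H $$ (i,i)"
    using ij carrier_matD[OF H] unfolding FtF by simp
  also have "\<dots> \<in> P" using mat_inD[OF HR H ij(1) ij(1)] by (simp add: loc_ideal_def)
  also have "(F * transpose_mat F) $$ (i,i) = (\<Sum>k<n. F $$ (i,k) * F $$ (i,k))"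
    using ij by (simp add: scalar_prod_def atLeast0LessThan)
  finally have "(\<Sum>k<n. F $$ (i,k) * F $$ (i,k)) \<in> P" .
  moreover have "(\<Sum>k<n. F $$ (i,k) * F $$ (i,k)) - (\<Sum>k<n. F $$ (i,k)) \<in> P"
    by (intro sum_in_P_if_sum_squares_in_P p) (use mat_inD[OF FR F ij(1)] in auto)
  moreover have "(\<Sum>k<n. F $$ (i,k)) = x $ i"
    unfolding Fe[symmetric] using mult_mat_vec_sum[OF F e_carrier ij(1)] by (simp del: index_mult_mat_vec)
  ultimately have "x $ i \<in> P"
    using P_diff[of "\<Sum>k<n. F $$ (i,k) * F $$ (i,k)" "(\<Sum>k<n. F $$ (i,k) * F $$ (i,k)) - x $ i"] by simp
  then show "Q $$ (i,j) \<in> R" unfolding x_i by (simp add: loc_ideal_def)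
qed

end

section \<open>From local integrality to integers, and levels\<close>

lemma Ints_if_localizations:
  assumes "\<And>p. prime p \<Longrightarrow> x \<in> localization p"
  shows "x \<in> \<int>"
proof -
  obtain a b where ab: "quotient_of x = (a, b)" by (cases "quotient_of x")
  have x: "x = of_int a / of_int b" using quotient_of_div[OF ab] .
  have b: "0 < b" using quotient_of_denom_pos[OF ab] .
  have cop: "coprime a b" using quotient_of_coprime[OF ab] .
  show ?thesis
  proof (cases "b = 1")
    case True
    then show ?thesis using x by simp
  next
    case False
    then obtain p where p: "prime p" "p dvd b" using b prime_divisor_exists[of b] by auto
    obtain m c where m: "\<not> p dvd m" "of_int m * x = of_int c"
      using assms[OF p(1)] by (auto simp: localization_def elim!: Ints_cases)
    have "(of_int (m * a) :: rat) = of_int (c * b)" using m(2) x b by (simp add: field_simps)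
    then have "m * a = c * b" by (simp only: of_int_eq_iff)
    then have "p dvd m * a" using p by simp
    then have "p dvd a" using m p by (simp add: prime_dvd_mult_iff)
    with cop p have "is_unit p" by (meson coprime_common_divisor)
    then show ?thesis using p(1) by auto
  qed
qed

lemma common_denominator:
  assumes "finite X"
  shows "\<exists>k::nat. 0 < k \<and> (\<forall>x\<in>X. of_nat k * x \<in> (\<int> :: rat set))"
  using assms
proof induction
  case empty
  then show ?case by auto
next
  case (insert x X)
  then obtain k :: nat where k: "0 < k" "\<forall>y\<in>X. of_nat k * y \<in> (\<int> :: rat set)" by blast
  obtain a b where ab: "quotient_of x = (a, b)" by (cases "quotient_of x")
  have b: "0 < b" using quotient_of_denom_pos[OF ab] .
  have "of_nat (k * nat b) * x = (of_nat k * of_int a :: rat)"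
    using quotient_of_div[OF ab] b by simp
  also have "\<dots> \<in> \<int>" by (intro Ints_mult) auto
  finally have "of_nat (k * nat b) * x \<in> \<int>" .
  moreover have "of_nat (k * nat b) * y \<in> \<int>" if "y \<in> X" for y
  proof -
    have "of_nat (nat b) * (of_nat k * y) \<in> \<int>" by (rule Ints_mult) (use k that in auto)
    then show ?thesis by (simp add: mult_ac)
  qed
  ultimately show ?case using k b by (intro exI[of _ "k * nat b"]) auto
qed

text \<open>The finitely many entries have a common denominator, so the least element in the
  definition of \<open>level\<close> is attained.\<close>

lemma level_integral:
  shows "0 < level n Q" and "i < n \<Longrightarrow> j < n \<Longrightarrow> of_nat (level n Q) * Q $$ (i,j) \<in> \<int>"
proof -
  have "finite ((\<lambda>(i,j). Q $$ (i,j)) ` ({..<n} \<times> {..<n}))" by simp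
  from common_denominator[OF this]
  have "\<exists>k::nat. 0 < k \<and> (\<forall>i<n. \<forall>j<n. of_nat k * Q $$ (i,j) \<in> \<int>)" by auto
  from LeastI_ex[OF this]
  show "0 < level n Q" "i < n \<Longrightarrow> j < n \<Longrightarrow> of_nat (level n Q) * Q $$ (i,j) \<in> \<int>"
    by (auto simp: level_def)
qed

text \<open>The multipliers that make \<open>Q\<close> integral form an ideal of the integers,
  generated by its least positive element: the remainder of \<open>k\<close> would otherwise be a
  smaller one.\<close>

lemma level_dvd:
  assumes "\<And>i j. i < n \<Longrightarrow> j < n \<Longrightarrow> of_nat k * Q $$ (i,j) \<in> \<int>"
  shows "level n Q dvd k"
proof (rule ccontr)
  let ?l = "level n Q" and ?r = "k mod level n Q"
  assume "\<not> ?l dvd k"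
  then have r: "0 < ?r" by (simp add: dvd_eq_mod_eq_0)
  have "of_nat ?r * Q $$ (i,j) \<in> \<int>" if "i < n" "j < n" for i j
  proof -
    have "(of_nat k :: rat) = of_nat (k div ?l) * of_nat ?l + of_nat ?r"
      by (metis of_nat_add of_nat_mult div_mult_mod_eq)
    then have "of_nat ?r * Q $$ (i,j) = of_nat k * Q $$ (i,j) - of_nat (k div ?l) * (of_nat ?l * Q $$ (i,j))"
      by (simp add: algebra_simps)
    also have "\<dots> \<in> \<int>" by (rule Ints_diff[OF assms[OF that] Ints_mult[OF Ints_of_nat level_integral(2)[OF that]]])
    finally show ?thesis .
  qed
  with r have "?l \<le> ?r" unfolding level_def by (intro Least_le) auto
  moreover have "?r < ?l" using level_integral(1) by simp
  ultimately show False by simp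
qed

lemma skew_walk_skew_adj:
  assumes "oriented_graph n A" shows "skew_walk n (skew_adj n A) (all_one_vec n)"
proof
  show "transpose_mat (skew_adj n A) = - skew_adj n A"
    using assms by (intro eq_matI) (auto simp: skew_adj_def oriented_graph_def)
qed (auto simp: skew_adj_def mat_in_def)

theorem theorem1p4:
  fixes n :: nat and A :: "nat \<Rightarrow> nat \<Rightarrow> bool" and Q0 Q :: "rat mat"
  assumes "in_G n A"
    and "regular_rat_orth n Q0"
    and "transpose_mat Q0 * skew_adj n A * Q0 = skew_adj n (converse_og A)"
    and "Q \<in> Qset n A"
  shows "level n Q dvd level n Q0"
proof -
  let ?S = "skew_adj n A" and ?e = "all_one_vec n"
  from assms(1) obtain k :: int where og: "oriented_graph n A" and k: "odd k" "squarefree k"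
    "det (walk_matrix n A) = 2 ^ (n div 2) * of_int k" by (auto simp: in_G_def)
  from assms(4) obtain B where regQ: "regular_rat_orth n Q" and B: "oriented_graph n B"
    "transpose_mat Q * ?S * Q = skew_adj n B" by (auto simp: Qset_def)
  interpret skew_walk n ?S ?e by (rule skew_walk_skew_adj[OF og])
  interpret B: skew_walk n "skew_adj n B" ?e by (rule skew_walk_skew_adj[OF B(1)])
  interpret skew_conj n ?S ?e "skew_adj n B" Q
    by unfold_locales (use regQ B in \<open>auto simp: regular_rat_orth_def\<close>)
  have detW: "det W = 2 ^ (n div 2) * of_int k"
  proof -
    have "W = walk_matrix n A" by (simp add: W_def krylov_def walk_matrix_def)
    then show ?thesis using k(3) by simp
  qed
  have conv: "skew_adj n (converse_og A) = - ?S"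
    using og by (intro eq_matI) (auto simp: skew_adj_def converse_og_def oriented_graph_def)
  have det0: "det W \<noteq> 0" using detW k(1) by auto
  have "of_nat (level n Q0) * Q $$ (i,j) \<in> localization p" if p: "prime p" and ij: "i < n" "j < n" for p i j
  proof -
    interpret skew_conj_at_prime n ?S ?e "skew_adj n B" Q p
      by unfold_locales (use p det0 in auto)
    have l: "of_nat (level n Q0) \<in> R" using R_of_int[of "int (level n Q0)"] by simp
    have QR: ?thesis if "mat_in R Q"
      using R_mult[OF l] mat_inD[OF that Q ij] by simp
    have detW': "det W = of_int (2 ^ (n div 2) * k)" using detW by simp
    consider "p = 2" | "p \<noteq> 2" "\<not> p dvd k" | "p \<noteq> 2" "p dvd k" by blast
    then show ?thesis
    proof cases
      case 1
      then have "(of_int k :: rat) \<notin> P" using k(1) of_int_in_P_iff by simp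
      then show ?thesis using QR Q_R_at_2[OF 1 detW] by simp
    next
      case 2
      have "\<not> p dvd 2 ^ (n div 2)" using p 2(1) primes_dvd_imp_eq[of p 2] by (auto dest: prime_dvd_power)
      then have "det W \<notin> P" unfolding detW' of_int_in_P_iff using 2 p by (simp add: prime_dvd_mult_iff)
      then show ?thesis using QR Q_R_if_det_unit by simp
    next
      case 3
      have p2: "\<not> p dvd 2" using p 3(1) primes_dvd_imp_eq[of p 2] by auto
      then have 2: "\<not> p dvd 2 ^ (n div 2)" using p by (auto dest: prime_dvd_power)
      obtain c where c: "k = p * c" using 3 by auto
      have "\<not> p dvd c"
      proof
        assume "p dvd c"
        then have "p ^ 2 dvd k" using c by (auto simp: power2_eq_square)
        then show False using k(2) p unfolding squarefree_def by (meson not_prime_unit)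
      qed
      then have nd: "\<not> p dvd 2 ^ (n div 2) * c" using 2 p by (simp add: prime_dvd_mult_iff)
      have detp: "det W / of_int p = of_int (2 ^ (n div 2) * c)" using detW c by simp
      have dP: "det W \<in> P" unfolding detW' c by (rule of_int_in_P) simp
      have dpP: "det W / of_int p \<notin> P" unfolding detp of_int_in_P_iff by (rule nd)
      \<comment> \<open>Either the level of \<open>Q0\<close> supplies the one factor
        \<open>p\<close> that can be missing, or it is prime to \<open>p\<close> and is a
        denominator showing that \<open>Q0\<close> is integral at \<open>p\<close>.\<close>
      show ?thesis
      proof (cases "p dvd int (level n Q0)")
        case True
        then obtain m where m: "int (level n Q0) = p * m" by auto
        then have "(of_nat (level n Q0) :: rat) = of_int p * of_int m" by (metis of_int_mult of_int_of_nat_eq)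
        then have "of_nat (level n Q0) * Q $$ (i,j) = of_int m * (of_int p * Q $$ (i,j))" by simp
        moreover have "of_int p * Q $$ (i,j) \<in> R"
          by (rule p_Q_R[OF _ dpP ij]) (simp add: detp del: of_int_mult)
        ultimately show ?thesis using R_mult[OF R_of_int[of m]] by metis
      next
        case False
        have Q0: "Q0 \<in> carrier_mat n n" "transpose_mat Q0 * Q0 = 1\<^sub>m n" "Q0 *\<^sub>v ?e = ?e"
          using assms(2) by (auto simp: regular_rat_orth_def)
        have "mat_in R Q0"
          unfolding mat_in_def
        proof (intro allI impI)
          fix r s assume "r < dim_row Q0" "s < dim_col Q0"
          then have "of_nat (level n Q0) * Q0 $$ (r,s) \<in> \<int>" using Q0(1) by (intro level_integral(2)) auto
          then show "Q0 $$ (r,s) \<in> R"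
            unfolding localization_def using False by (auto intro!: exI[of _ "int (level n Q0)"])
        qed
        moreover have "(2::rat) \<notin> P" using of_int_in_P_iff[of 2] p2 by simp
        ultimately have "mat_in R Q"
          using Q_R_if_Q0_R[OF _ dP dpP Q0] assms(3) conv by simp
        then show ?thesis by (rule QR)
      qed
    qed
  qed
  then show ?thesis by (intro level_dvd Ints_if_localizations) auto
qed

end
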